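(* Let $2\leq k\leq r$ be integers and let $\alpha,\gamma>0$. Then there exists $C=C(\alpha,\gamma,r,k)>0$ such that if $p=p(n)\geq Cn^{-2/k}$ and $G$ is an $n$-vertex graph with $\delta(G)\geq(1-\frac{k}{r}+\gamma)n$, then asymptotically almost surely $G\cup G(n,p)$ contains a $K_r$-tiling covering all but at most $\alpha n$ vertices.
   Context: A $K_r$-tiling is a collection of vertex-disjoint copies of $K_r$. $G(n,p)$ is the binomial random graph on the vertex set of $G$ (identified with $[n]$), and $G\cup G(n,p)$ is the graph on $V(G)$ whose edge set is the union of the two edge sets. Asymptotically almost surely means with probability tending to $1$ as $n\to\infty$. *)

theory Defs
  imports Complex_Main
begin

definition all_pairs :: "nat \<Rightarrow> nat set set" where
  "all_pairs n = {{u, v} | u v. u < n \<and> v < n \<and> u \<noteq> v}"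

definition graph_on :: "nat \<Rightarrow> nat set set \<Rightarrow> bool" where
  "graph_on n E \<longleftrightarrow> E \<subseteq> all_pairs n"

definition degree :: "nat \<Rightarrow> nat set set \<Rightarrow> nat \<Rightarrow> nat" where
  "degree n E v = card {u. u < n \<and> {u, v} \<in> E}"

definition min_degree_ge :: "nat \<Rightarrow> nat set set \<Rightarrow> real \<Rightarrow> bool" where
  "min_degree_ge n E d \<longleftrightarrow> (\<forall>v<n. real (degree n E v) \<ge> d)"

definition is_clique :: "nat set set \<Rightarrow> nat set \<Rightarrow> bool" where
  "is_clique E S \<longleftrightarrow> (\<forall>u\<in>S. \<forall>v\<in>S. u \<noteq> v \<longrightarrow> {u, v} \<in> E)"

definition Kr_tiling :: "nat \<Rightarrow> nat \<Rightarrow> nat set set \<Rightarrow> nat set set \<Rightarrow> bool" where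
  "Kr_tiling n r E T \<longleftrightarrow>
     (\<forall>S\<in>T. S \<subseteq> {0..<n} \<and> card S = r \<and> is_clique E S) \<and>
     (\<forall>S\<in>T. \<forall>S'\<in>T. S \<noteq> S' \<longrightarrow> S \<inter> S' = {})"

definition random_graph_prob :: "nat \<Rightarrow> real \<Rightarrow> (nat set set \<Rightarrow> bool) \<Rightarrow> real" where
  "random_graph_prob n p P =
     (\<Sum>F\<in>Pow (all_pairs n). if P F then p ^ card F * (1 - p) ^ (card (all_pairs n) - card F) else 0)"

end

(* Write r = j k + s with 1 <= s <= k. A complete (j+1)-partite subgraph of G with parts of sizes
   k, ..., k, s whose parts are cliques of the random graph is a copy of K_r. By Janson's inequality,
   a random graph of density C n^(-2/k) avoids all members of a given family of linearly dense k-sets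
   with probability exp(-Omega(C n)). This allows a union bound over all exp(O(n)) families that arise
   as "k-subsets of Z that extend to many cliques in Z_1, ..., Z_q", and hence any Z_0, ..., Z_j that
   span a positive density of transversal cliques of G contain such a copy of K_r.

   The tiling is built greedily, keeping the degrees of almost all vertices into the uncovered set U
   proportional. The squared deviations are the potential; their gradient defines a weight y on the
   vertices whose sum over U is the potential itself, so nonnegative. A copy of K_r on which y is not
   much below average barely increases the potential. It exists because the quantile sets of y span many
   cliques: this is where the minimum degree (1 - k/r + gamma) n enters. *)
theory Submission
  imports Defs
begin

section \<open>Random subsets and Janson's inequality\<close>

text \<open>The obstacle is adaptivity: \<open>F\<close> is exposed once, yet the uncovered set at
  each greedy step depends on \<open>F\<close>. So a single event, \<open>hits_extensible\<close>,
  must serve all possible choices at once. The union bound affords this because a bounded number of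
  vertex subsets can be chosen in exp(O(n)) ways, the order of the Janson bound, and C can be taken
  large.

  A nonnegative weight sum over U means that removing an average r-set does not increase the
  potential to first order. Only a nearly average tile is available, and its deficit is \<eta> times
  the bound on the weights. That bound follows from the potential itself and is of order \<eta> n^2,
  so a step costs O(\<eta>^2 n^2) and the whole process O(\<eta>^2 n^3). A vertex whose degree into
  U has dropped too low accounts for order n^2 of the potential, hence only O(\<eta>^2 n) vertices
  are bad, fewer than the room of order \<eta> n left in the quantile sets.\<close>

definition subset_prob :: "'a set \<Rightarrow> real \<Rightarrow> ('a set \<Rightarrow> bool) \<Rightarrow> real" where
  "subset_prob E p P =
     (\<Sum>F\<in>Pow E. if P F then p ^ card F * (1 - p) ^ (card E - card F) else 0)"

lemma random_graph_prob_eq_subset_prob: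
  "random_graph_prob n p P = subset_prob (all_pairs n) p P"
  by (simp add: random_graph_prob_def subset_prob_def)

lemma subset_prob_cong:
  assumes "\<And>F. F \<subseteq> E \<Longrightarrow> P F = Q F"
  shows "subset_prob E p P = subset_prob E p Q"
  unfolding subset_prob_def by (rule sum.cong) (use assms in auto)

lemma subset_prob_insert:
  assumes "finite E" "e \<notin> E"
  shows "subset_prob (insert e E) p P =
    p * subset_prob E p (\<lambda>F. P (insert e F)) + (1 - p) * subset_prob E p P"
proof -
  let ?f = "\<lambda>F. if P F then p ^ card F * (1 - p) ^ (card (insert e E) - card F) else 0"
  have inj: "inj_on (insert e) (Pow E)"
    using assms(2) by (auto simp: inj_on_def)
  have "subset_prob (insert e E) p P = sum ?f (Pow E) + sum ?f (insert e ` Pow E)"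
    unfolding subset_prob_def Pow_insert
    by (rule sum.union_disjoint) (use assms in auto)
  also have "sum ?f (insert e ` Pow E) = p * subset_prob E p (\<lambda>F. P (insert e F))"
    unfolding sum.reindex[OF inj] subset_prob_def sum_distrib_left
  proof (rule sum.cong)
    fix F assume "F \<in> Pow E"
    then have "finite F" "e \<notin> F" using assms finite_subset by auto
    then show "(?f \<circ> insert e) F =
      p * (if P (insert e F) then p ^ card F * (1 - p) ^ (card E - card F) else 0)"
      using assms by simp
  qed simp
  also have "sum ?f (Pow E) = (1 - p) * subset_prob E p P"
    unfolding subset_prob_def sum_distrib_left
  proof (rule sum.cong)
    fix F assume "F \<in> Pow E"
    then have "card F \<le> card E" using assms card_mono by auto
    then show "?f F = (1 - p) * (if P F then p ^ card F * (1 - p) ^ (card E - card F) else 0)"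
      using assms by (simp add: Suc_diff_le)
  qed simp
  finally show ?thesis by simp
qed

lemma subset_prob_mono:
  assumes "0 \<le> p" "p \<le> 1" "\<And>F. F \<subseteq> E \<Longrightarrow> P F \<Longrightarrow> Q F"
  shows "subset_prob E p P \<le> subset_prob E p Q"
  unfolding subset_prob_def by (rule sum_mono) (use assms in auto)

lemma subset_prob_nonneg:
  assumes "0 \<le> p" "p \<le> 1"
  shows "0 \<le> subset_prob E p P"
  unfolding subset_prob_def by (rule sum_nonneg) (use assms in auto)

lemma subset_prob_True:
  assumes "finite E"
  shows "subset_prob E p (\<lambda>F. True) = 1"
  using assms
proof (induction E)
  case empty
  show ?case by (simp add: subset_prob_def)
next
  case (insert e E)
  then show ?case by (simp add: subset_prob_insert)
qed

lemma subset_prob_add: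
  "subset_prob E p P = subset_prob E p (\<lambda>F. P F \<and> Q F) + subset_prob E p (\<lambda>F. P F \<and> \<not> Q F)"
  unfolding subset_prob_def sum.distrib[symmetric] by (rule sum.cong) auto

lemma subset_prob_not:
  assumes "finite E"
  shows "subset_prob E p (\<lambda>F. \<not> P F) = 1 - subset_prob E p P"
  using subset_prob_add[of E p "\<lambda>F. True" P] subset_prob_True[OF assms] by simp

lemma subset_prob_le_1:
  assumes "finite E" "0 \<le> p" "p \<le> 1"
  shows "subset_prob E p P \<le> 1"
  using subset_prob_mono[OF assms(2,3), of E P "\<lambda>F. True"] subset_prob_True[OF assms(1)] by simp

lemma subset_prob_ex_le_sum:
  assumes "0 \<le> p" "p \<le> 1" "finite I"
  shows "subset_prob E p (\<lambda>F. \<exists>i\<in>I. P i F) \<le> (\<Sum>i\<in>I. subset_prob E p (P i))"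
  using assms(3)
proof (induction I)
  case empty
  show ?case by (simp add: subset_prob_def)
next
  case (insert i I)
  have "subset_prob E p (\<lambda>F. \<exists>j\<in>insert i I. P j F) \<le>
    subset_prob E p (P i) + subset_prob E p (\<lambda>F. \<exists>j\<in>I. P j F)"
    unfolding subset_prob_def sum.distrib[symmetric]
    by (rule sum_mono) (use assms in auto)
  then show ?case using insert by simp
qed

text \<open>Replaces a coupling of two densities: exposing one element at a time, a larger p moves
  weight from the case without the element to the case with it, which is at least as likely for an
  up-set. It suffices therefore to treat density exactly
  \<open>C * real n powr (- 2 / real k)\<close>.\<close>

lemma subset_prob_mono_p:
  assumes "finite E" "0 \<le> p" "p \<le> p'" "p' \<le> 1"
    and "\<And>F F'. P F \<Longrightarrow> F \<subseteq> F' \<Longrightarrow> P F'"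
  shows "subset_prob E p P \<le> subset_prob E p' P"
  using assms(1,5)
proof (induction E arbitrary: P)
  case empty
  show ?case by (cases "P {}") (simp_all add: subset_prob_def)
next
  case (insert e E)
  let ?P' = "\<lambda>F. P (insert e F)"
  have 1: "subset_prob E p P \<le> subset_prob E p' P"
    by (rule insert.IH) (use insert.prems in blast)
  have 2: "subset_prob E p ?P' \<le> subset_prob E p' ?P'"
    by (rule insert.IH) (use insert.prems in blast)
  have 3: "subset_prob E p' P \<le> subset_prob E p' ?P'"
  proof (rule subset_prob_mono)
    show "P (insert e F)" if "P F" for F
      using insert.prems that by blast
  qed (use assms in auto)
  have "p * subset_prob E p ?P' + (1 - p) * subset_prob E p P \<le>
    p * subset_prob E p' ?P' + (1 - p) * subset_prob E p' P"
    using 1 2 assms by (intro add_mono mult_left_mono) auto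
  also have "\<dots> \<le> p' * subset_prob E p' ?P' + (1 - p') * subset_prob E p' P"
    using mult_right_mono[OF assms(3), of "subset_prob E p' ?P' - subset_prob E p' P"] 3
    by (simp add: algebra_simps)
  finally show ?case using insert.hyps by (simp add: subset_prob_insert)
qed

lemma subset_prob_superset:
  assumes "finite E" "S \<subseteq> E"
  shows "subset_prob E p (\<lambda>F. S \<subseteq> F \<and> P F) = p ^ card S * subset_prob E p (\<lambda>F. P (F \<union> S))"
proof -
  have *: "subset_prob E p (\<lambda>F. e \<in> F \<and> P F) = p * subset_prob E p (\<lambda>F. P (insert e F))"
    if e: "e \<in> E" for e P
  proof -
    define E' where "E' = E - {e}"
    have E: "E = insert e E'" "e \<notin> E'" "finite E'"
      using assms(1) e by (auto simp: E'_def)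
    have "subset_prob E' p (\<lambda>F. e \<in> F \<and> P F) = subset_prob E' p (\<lambda>F. False)"
      by (rule subset_prob_cong) (use E in auto)
    then have "subset_prob E' p (\<lambda>F. e \<in> F \<and> P F) = 0" by (simp add: subset_prob_def)
    then show ?thesis unfolding E(1) by (simp add: subset_prob_insert E algebra_simps)
  qed
  have "finite S" using assms finite_subset by blast
  then show ?thesis using assms(2)
  proof (induction S arbitrary: P)
    case empty
    show ?case by simp
  next
    case (insert e S)
    have "subset_prob E p (\<lambda>F. insert e S \<subseteq> F \<and> P F)
      = subset_prob E p (\<lambda>F. e \<in> F \<and> (S \<subseteq> F \<and> P F))" by simp
    also have "\<dots> = p * subset_prob E p (\<lambda>F. S \<subseteq> insert e F \<and> P (insert e F))"
      using * insert.prems by simp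
    also have "\<dots> = p * subset_prob E p (\<lambda>F. S \<subseteq> F \<and> P (insert e F))"
      using insert.hyps by (simp add: subset_insert)
    also have "\<dots> = p * (p ^ card S * subset_prob E p (\<lambda>F. P (insert e (F \<union> S))))"
      using insert by simp
    finally show ?case using insert.hyps by simp
  qed
qed

text \<open>Because conditioning on \<open>A \<subseteq> F\<close> just replaces \<open>F\<close> by \<open>F \<union> A\<close>, the usual
  appeal to the Harris inequality reduces to monotonicity.\<close>

lemma janson:
  assumes fin: "finite E" and p: "0 \<le> p" "p \<le> 1"
    and \<A>: "finite \<A>" "\<And>A. A \<in> \<A> \<Longrightarrow> A \<subseteq> E"
    and a: "\<And>A. A \<in> \<A> \<Longrightarrow> a \<le> p ^ card A"
    and d: "\<And>A. A \<in> \<A> \<Longrightarrow> (\<Sum>B\<in>{B\<in>\<A>. B \<noteq> A \<and> B \<inter> A \<noteq> {}}. p ^ card (A \<union> B)) \<le> d"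
    and ad: "d \<le> a"
  shows "subset_prob E p (\<lambda>F. \<forall>A\<in>\<A>. \<not> A \<subseteq> F) \<le> exp (- (a - d) * real (card \<A>))"
proof -
  have "subset_prob E p (\<lambda>F. \<forall>A\<in>\<B>. \<not> A \<subseteq> F) \<le> exp (- (a - d) * real (card \<B>))"
    if "\<B> \<subseteq> \<A>" for \<B>
    using finite_subset[OF that \<A>(1)] that
  proof (induction \<B>)
    case empty
    show ?case using subset_prob_True[OF fin] by simp
  next
    case (insert A \<B>)
    have A: "A \<in> \<A>" "A \<subseteq> E" and \<B>: "\<B> \<subseteq> \<A>"
      using insert.prems \<A>(2) by auto
    have finA: "finite A" using A(2) fin by (rule finite_subset)
    \<comment> \<open>The earlier sets are split by whether they meet \<open>A\<close>. Adding
      \<open>A\<close> to \<open>F\<close> does not affect \<open>D\<close>, which concerns only the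
      disjoint ones; the sets in \<open>N\<close> are paid for through their parts outside
      \<open>A\<close>.\<close>
    define N where "N = {B\<in>\<B>. B \<inter> A \<noteq> {}}"
    define avoid where "avoid F \<longleftrightarrow> (\<forall>B\<in>\<B>. \<not> B \<subseteq> F)" for F
    define D where "D F \<longleftrightarrow> (\<forall>B\<in>\<B>. B \<inter> A = {} \<longrightarrow> \<not> B \<subseteq> F)" for F
    let ?pr = "subset_prob E p"
    have finN: "finite N" using insert.hyps by (simp add: N_def)
    have union: "?pr (\<lambda>F. \<exists>B\<in>N. D F \<and> B - A \<subseteq> F) \<le> (\<Sum>B\<in>N. p ^ card (B - A)) * ?pr D"
    proof -
      have "?pr (\<lambda>F. D F \<and> B - A \<subseteq> F) \<le> p ^ card (B - A) * ?pr D" if "B \<in> N" for B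
      proof -
        have BE: "B - A \<subseteq> E" using that \<B> \<A>(2) by (auto simp: N_def)
        have "?pr (\<lambda>F. D F \<and> B - A \<subseteq> F) = ?pr (\<lambda>F. B - A \<subseteq> F \<and> D F)"
          by (rule subset_prob_cong) auto
        also have "\<dots> = p ^ card (B - A) * ?pr (\<lambda>F. D (F \<union> (B - A)))"
          by (rule subset_prob_superset[OF fin BE])
        also have "\<dots> \<le> p ^ card (B - A) * ?pr D"
          by (intro mult_left_mono subset_prob_mono) (use p in \<open>auto simp: D_def\<close>)
        finally show ?thesis .
      qed
      then show ?thesis
        using subset_prob_ex_le_sum[OF p finN, of E "\<lambda>B F. D F \<and> B - A \<subseteq> F"]
        unfolding sum_distrib_right by (meson order_trans sum_mono)
    qed
    have "?pr D = ?pr (\<lambda>F. D F \<and> (\<exists>B\<in>N. B - A \<subseteq> F)) + ?pr (\<lambda>F. D F \<and> \<not> (\<exists>B\<in>N. B - A \<subseteq> F))"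
      by (rule subset_prob_add)
    also have "?pr (\<lambda>F. D F \<and> (\<exists>B\<in>N. B - A \<subseteq> F)) = ?pr (\<lambda>F. \<exists>B\<in>N. D F \<and> B - A \<subseteq> F)"
      by (rule subset_prob_cong) auto
    also have "?pr (\<lambda>F. D F \<and> \<not> (\<exists>B\<in>N. B - A \<subseteq> F)) \<le> ?pr (\<lambda>F. avoid (F \<union> A))"
    proof (rule subset_prob_mono[OF p])
      fix F assume *: "D F \<and> \<not> (\<exists>B\<in>N. B - A \<subseteq> F)"
      show "avoid (F \<union> A)"
        unfolding avoid_def
      proof
        fix B assume B: "B \<in> \<B>"
        show "\<not> B \<subseteq> F \<union> A"
        proof (cases "B \<inter> A = {}")
          case True
          then have "\<not> B \<subseteq> F" using * B by (simp add: D_def)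
          then show ?thesis using True by blast
        next
          case False
          then have "\<not> B - A \<subseteq> F" using * B unfolding N_def by blast
          then show ?thesis by blast
        qed
      qed
    qed
    finally have low: "(1 - (\<Sum>B\<in>N. p ^ card (B - A))) * ?pr D \<le> ?pr (\<lambda>F. avoid (F \<union> A))"
      using union by (simp add: algebra_simps)
    have "(\<Sum>B\<in>N. p ^ card A * p ^ card (B - A)) = (\<Sum>B\<in>N. p ^ card (A \<union> B))"
    proof (rule sum.cong)
      fix B assume "B \<in> N"
      then have "finite B" using \<B> \<A>(2)[of B] finite_subset[OF _ fin] by (auto simp: N_def)
      then have "card (A \<union> B) = card A + card (B - A)"
        using card_Un_disjoint[of A "B - A"] finA by simp
      then show "p ^ card A * p ^ card (B - A) = p ^ card (A \<union> B)" by (simp add: power_add)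
    qed simp
    also have "\<dots> \<le> (\<Sum>B\<in>{B\<in>\<A>. B \<noteq> A \<and> B \<inter> A \<noteq> {}}. p ^ card (A \<union> B))"
      by (rule sum_mono2) (use \<A>(1) p \<B> insert.hyps in \<open>auto simp: N_def\<close>)
    also have "\<dots> \<le> d" by (rule d[OF A(1)])
    finally have Nd: "p ^ card A * (\<Sum>B\<in>N. p ^ card (B - A)) \<le> d"
      by (simp add: sum_distrib_left)
    \<comment> \<open>Given avoidance so far, \<open>A\<close> is contained with conditional
      probability at least \<open>a - d\<close>. Relaxing \<open>avoid\<close> to \<open>D\<close>
      goes in the right direction because \<open>a - d\<close> is nonnegative.\<close>
    have "(a - d) * ?pr avoid \<le> (a - d) * ?pr D"
      by (intro mult_left_mono subset_prob_mono) (use ad p in \<open>auto simp: avoid_def D_def\<close>)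
    also have "\<dots> \<le> (p ^ card A - p ^ card A * (\<Sum>B\<in>N. p ^ card (B - A))) * ?pr D"
      by (intro mult_right_mono subset_prob_nonneg p) (use Nd a[OF A(1)] in linarith)
    also have "\<dots> = p ^ card A * ((1 - (\<Sum>B\<in>N. p ^ card (B - A))) * ?pr D)"
      by (simp add: algebra_simps)
    also have "\<dots> \<le> p ^ card A * ?pr (\<lambda>F. avoid (F \<union> A))"
      by (rule mult_left_mono[OF low]) (use p in simp)
    also have "\<dots> = ?pr (\<lambda>F. A \<subseteq> F \<and> avoid F)"
      by (rule subset_prob_superset[OF fin A(2), symmetric])
    also have "\<dots> = ?pr (\<lambda>F. avoid F \<and> A \<subseteq> F)"
      by (rule subset_prob_cong) auto
    finally have step: "(a - d) * ?pr avoid \<le> ?pr (\<lambda>F. avoid F \<and> A \<subseteq> F)" .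
    have "?pr (\<lambda>F. \<forall>B\<in>insert A \<B>. \<not> B \<subseteq> F) = ?pr (\<lambda>F. avoid F \<and> \<not> A \<subseteq> F)"
      by (rule subset_prob_cong) (auto simp: avoid_def)
    also have "\<dots> \<le> (1 - (a - d)) * ?pr avoid"
      using step subset_prob_add[of E p avoid "\<lambda>F. A \<subseteq> F"] by (simp add: algebra_simps)
    also have "\<dots> \<le> exp (- (a - d)) * ?pr avoid"
      by (intro mult_right_mono subset_prob_nonneg p) (use exp_ge_add_one_self[of "- (a - d)"] in linarith)
    also have "\<dots> \<le> exp (- (a - d)) * exp (- (a - d) * real (card \<B>))"
      using insert.IH[OF \<B>] by (simp add: avoid_def[abs_def])
    also have "\<dots> = exp (- (a - d) * real (card (insert A \<B>)))"
      using insert.hyps by (simp add: exp_add[symmetric] algebra_simps)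
    finally show ?case .
  qed
  then show ?thesis by blast
qed

section \<open>Cliques of the random graph in dense families\<close>

abbreviation pairs :: "'a set \<Rightarrow> 'a set set" where
  "pairs S \<equiv> {e. e \<subseteq> S \<and> card e = 2}"

lemma all_pairs_eq_pairs: "all_pairs n = pairs {0..<n}"
proof
  show "all_pairs n \<subseteq> pairs {0..<n}" by (auto simp: all_pairs_def)
  show "pairs {0..<n} \<subseteq> all_pairs n"
  proof
    fix e assume e: "e \<in> pairs {0..<n}"
    then obtain u v where "e = {u, v}" "u \<noteq> v" by (auto simp: card_2_iff)
    then show "e \<in> all_pairs n" using e unfolding all_pairs_def by fastforce
  qed
qed

lemma finite_all_pairs: "finite (all_pairs n)"
  unfolding all_pairs_eq_pairs by simp

lemma is_clique_iff_pairs: "is_clique F S \<longleftrightarrow> pairs S \<subseteq> F"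
proof
  assume *: "is_clique F S"
  show "pairs S \<subseteq> F"
    using * by (auto simp: is_clique_def card_2_iff)
next
  assume *: "pairs S \<subseteq> F"
  show "is_clique F S"
    unfolding is_clique_def
  proof (intro ballI impI)
    fix u v assume "u \<in> S" "v \<in> S" "u \<noteq> v"
    then have "{u, v} \<in> pairs S" by simp
    then show "{u, v} \<in> F" using * by blast
  qed
qed

lemma card_pairs: "finite S \<Longrightarrow> card (pairs S) = card S choose 2"
  using n_subsets[of S 2] by simp

lemma pairs_Int: "pairs S \<inter> pairs S' = pairs (S \<inter> S')"
  by auto

text \<open>Janson's inequality sees only edge sets; this lets it count vertex sets. Singletons are
  excluded because they share the empty edge set with the empty set.\<close>

lemma inj_on_pairs: "inj_on pairs {S. card S \<noteq> 1}"
proof -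
  have sub: "S \<subseteq> S'" if "card S \<noteq> 1" "pairs S = pairs S'" for S S' :: "'a set"
  proof
    fix x assume x: "x \<in> S"
    have "S \<noteq> {x}" using that(1) by auto
    then obtain y where "y \<in> S" "y \<noteq> x" using x by blast
    then have "{x, y} \<in> pairs S" using x by simp
    then have "{x, y} \<in> pairs S'" using that(2) by simp
    then show "x \<in> S'" by simp
  qed
  show ?thesis
    by (rule inj_onI) (metis (mono_tags, lifting) sub mem_Collect_eq subset_antisym)
qed

lemma binomial_le_power: "n choose k \<le> n ^ k"
  by (cases "k \<le> n") (simp_all add: binomial_le_pow binomial_eq_0)

text \<open>A set is determined by its trace on \<open>S\<close> and its part outside. Bounding the
  traces by all subsets of \<open>S\<close> costs only a constant, since \<open>S\<close> will have
  k elements.\<close>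

lemma card_subsets_Int_le:
  assumes "finite V" "finite S" "j \<le> k"
  shows "card {S'. S' \<subseteq> V \<and> card S' = k \<and> card (S' \<inter> S) = j} \<le> 2 ^ card S * card V ^ (k - j)"
proof -
  let ?A = "{S'. S' \<subseteq> V \<and> card S' = k \<and> card (S' \<inter> S) = j}"
  let ?B = "{W. W \<subseteq> V \<and> card W = k - j}"
  let ?f = "\<lambda>S'. (S' \<inter> S, S' - S)"
  have "card ?A \<le> card (Pow S \<times> ?B)"
  proof (rule card_inj_on_le)
    show "inj_on ?f ?A"
      by (rule inj_onI) (metis Int_Diff_Un prod.inject)
    show "?f ` ?A \<subseteq> Pow S \<times> ?B"
    proof
      fix z assume "z \<in> ?f ` ?A"
      then obtain S' where S': "z = ?f S'" "S' \<subseteq> V" "card S' = k" "card (S' \<inter> S) = j" by blast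
      have "card (S' - S) = card S' - card (S' \<inter> S)"
        using finite_subset[OF S'(2) assms(1)] by (intro card_Diff_subset_Int) simp
      then have "card (S' - S) = k - j" unfolding S'(3,4) .
      then show "z \<in> Pow S \<times> ?B" using S'(1,2) by blast
    qed
    show "finite (Pow S \<times> ?B)" using assms by auto
  qed
  also have "\<dots> = 2 ^ card S * (card V choose (k - j))"
    using assms by (simp add: card_cartesian_product card_Pow n_subsets)
  also have "\<dots> \<le> 2 ^ card S * card V ^ (k - j)"
    by (intro mult_left_mono binomial_le_power) simp
  finally show ?thesis .
qed

text \<open>If \<open>S\<close> is a \<open>k\<close>-set, then \<open>2 ^ k * n ^ (k - j)\<close> bounds the number of \<open>k\<close>-sets meeting it in
  \<open>j\<close> vertices, and the remaining factor is the conditional probability that such a set is a clique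
  given that \<open>S\<close> is one. For \<open>p\<close> of order \<open>n powr (- 2 / k)\<close> the exponent of \<open>n\<close> in the \<open>j\<close>-th
  term is \<open>- (j - 1) * (k - j) / k < 0\<close>.\<close>

definition overlap_bound :: "nat \<Rightarrow> real \<Rightarrow> nat \<Rightarrow> real" where
  "overlap_bound k p n =
     2 ^ k * (\<Sum>j\<in>{2..<k}. real n ^ (k - j) * p ^ ((k choose 2) - (j choose 2)))"

lemma prob_no_clique_le:
  fixes \<S> :: "nat set set"
  assumes p: "0 \<le> p" "p \<le> 1" and k: "2 \<le> k"
    and \<S>: "\<And>S. S \<in> \<S> \<Longrightarrow> S \<subseteq> {0..<n} \<and> card S = k"
    and ov: "overlap_bound k p n \<le> 1 / 2"
  shows "subset_prob (all_pairs n) p (\<lambda>F. \<forall>S\<in>\<S>. \<not> is_clique F S)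
    \<le> exp (- (p ^ (k choose 2) * real (card \<S>) / 2))"
proof -
  let ?e = "k choose 2" and ?a = "p ^ (k choose 2)"
  have fS: "finite S" if "S \<in> \<S>" for S
    using \<S>[OF that] finite_subset by blast
  have fin\<S>: "finite \<S>"
    by (rule finite_subset[of _ "Pow {0..<n}"]) (use \<S> in auto)
  have inj: "inj_on pairs \<S>"
    by (rule inj_on_subset[OF inj_on_pairs]) (use \<S> k in auto)
  have ce: "card (pairs S) = ?e" if "S \<in> \<S>" for S
    using card_pairs[OF fS[OF that]] \<S>[OF that] by simp
  have main: "(\<Sum>B\<in>{B\<in>pairs ` \<S>. B \<noteq> A \<and> B \<inter> A \<noteq> {}}. p ^ card (A \<union> B)) \<le> ?a / 2"
    if A: "A \<in> pairs ` \<S>" for A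
  proof -
    obtain S where S: "S \<in> \<S>" "A = pairs S" using A by auto
    note fS1 = fS[OF S(1)]
    define R where "R j = {S'\<in>\<S>. card (S' \<inter> S) = j}" for j
    \<comment> \<open>Edge sets that meet share an edge, hence the vertex sets share two vertices;
      distinct k-sets share fewer than k.\<close>
    have sub: "{B\<in>pairs ` \<S>. B \<noteq> A \<and> B \<inter> A \<noteq> {}} \<subseteq> pairs ` (\<Union>j\<in>{2..<k}. R j)"
    proof
      fix B assume "B \<in> {B\<in>pairs ` \<S>. B \<noteq> A \<and> B \<inter> A \<noteq> {}}"
      then have B: "B \<in> pairs ` \<S>" "B \<noteq> pairs S" "B \<inter> pairs S \<noteq> {}" using S(2) by blast+
      then obtain S' where S': "S' \<in> \<S>" "B = pairs S'" by blast
      have "S' \<noteq> S" "pairs S' \<inter> pairs S \<noteq> {}"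
        using B(2,3) S'(2) by blast+
      note S' = S' this
      then obtain e where "e \<subseteq> S' \<inter> S" "card e = 2" by (auto simp: disjoint_iff)
      then have "2 \<le> card (S' \<inter> S)" using card_mono[of "S' \<inter> S" e] fS1 by auto
      moreover have "card (S' \<inter> S) < k"
      proof -
        have "S' \<inter> S \<noteq> S"
        proof
          assume "S' \<inter> S = S"
          then have "S \<subseteq> S'" by blast
          then have "S = S'" using card_subset_eq[OF fS[OF S'(1)]] \<S> S(1) S'(1) by simp
          then show False using S'(3) by simp
        qed
        then have "card (S' \<inter> S) < card S" using fS1 by (intro psubset_card_mono) auto
        then show ?thesis using \<S>[OF S(1)] by simp
      qed
      ultimately have "S' \<in> (\<Union>j\<in>{2..<k}. R j)"
        using S'(1) by (simp add: R_def)
      then show "B \<in> pairs ` (\<Union>j\<in>{2..<k}. R j)"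
        unfolding S'(2) by (rule imageI)
    qed
    have finR: "finite (R j)" for j using fin\<S> by (simp add: R_def)
    have cardU: "card (A \<union> pairs S') = ?e + (?e - (j choose 2))" if "S' \<in> R j" "j < k" for S' j
    proof -
      have S': "S' \<in> \<S>" "card (S \<inter> S') = j" using that(1) by (auto simp: R_def Int_commute)
      have fin: "finite (pairs S)" "finite (pairs S')"
        using fS1 fS[OF S'(1)] by auto
      have "card (pairs S) + card (pairs S') = card (A \<union> pairs S') + card (pairs (S \<inter> S'))"
        using card_Un_Int[OF fin] S(2) by (simp add: pairs_Int)
      moreover have "card (pairs (S \<inter> S')) = j choose 2"
        using card_pairs[of "S \<inter> S'"] fS1 S'(2) by simp
      moreover have "j choose 2 \<le> ?e" using that(2) by (intro binomial_right_mono) auto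
      ultimately show ?thesis using ce[OF S(1)] ce[OF S'(1)] by linarith
    qed
    have cardR: "real (card (R j)) \<le> 2 ^ k * real n ^ (k - j)" if "j < k" for j
    proof -
      have "card (R j) \<le> card {S'. S' \<subseteq> {0..<n} \<and> card S' = k \<and> card (S' \<inter> S) = j}"
        by (rule card_mono) (use \<S> in \<open>auto simp: R_def\<close>)
      also have "\<dots> \<le> 2 ^ k * n ^ (k - j)"
        using card_subsets_Int_le[of "{0..<n}" S j k] that fS1 \<S>[OF S(1)] by simp
      finally have "real (card (R j)) \<le> real (2 ^ k * n ^ (k - j))" by (rule of_nat_mono)
      then show ?thesis by simp
    qed
    have "(\<Sum>B\<in>{B\<in>pairs ` \<S>. B \<noteq> A \<and> B \<inter> A \<noteq> {}}. p ^ card (A \<union> B))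
      \<le> (\<Sum>B\<in>pairs ` (\<Union>j\<in>{2..<k}. R j). p ^ card (A \<union> B))"
      by (rule sum_mono2[OF _ sub]) (use finR p in simp_all)
    also have "\<dots> = (\<Sum>S'\<in>(\<Union>j\<in>{2..<k}. R j). p ^ card (A \<union> pairs S'))"
    proof (subst sum.reindex)
      show "inj_on pairs (\<Union>j\<in>{2..<k}. R j)"
        by (rule inj_on_subset[OF inj]) (auto simp: R_def)
    qed simp
    also have "\<dots> = (\<Sum>j\<in>{2..<k}. \<Sum>S'\<in>R j. p ^ card (A \<union> pairs S'))"
      by (rule sum.UNION_disjoint) (use finR in \<open>auto simp: R_def\<close>)
    also have "\<dots> = (\<Sum>j\<in>{2..<k}. real (card (R j)) * p ^ (?e + (?e - (j choose 2))))"
      by (rule sum.cong) (simp_all add: cardU)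
    also have "\<dots> \<le> (\<Sum>j\<in>{2..<k}. 2 ^ k * real n ^ (k - j) * p ^ (?e + (?e - (j choose 2))))"
      by (intro sum_mono mult_right_mono cardR) (use p in auto)
    also have "\<dots> = ?a * overlap_bound k p n"
      unfolding overlap_bound_def sum_distrib_left by (rule sum.cong) (simp_all add: power_add)
    also have "\<dots> \<le> ?a * (1 / 2)" by (rule mult_left_mono[OF ov]) (use p in simp)
    finally show ?thesis by simp
  qed
  have "subset_prob (all_pairs n) p (\<lambda>F. \<forall>S\<in>\<S>. \<not> is_clique F S)
    = subset_prob (all_pairs n) p (\<lambda>F. \<forall>A\<in>pairs ` \<S>. \<not> A \<subseteq> F)"
    by (simp add: is_clique_iff_pairs)
  also have "\<dots> \<le> exp (- (?a - ?a / 2) * real (card (pairs ` \<S>)))"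
  proof (rule janson[OF finite_all_pairs p])
    show "finite (pairs ` \<S>)" using fin\<S> by simp
    show "A \<subseteq> all_pairs n" if "A \<in> pairs ` \<S>" for A
      using that \<S> unfolding all_pairs_eq_pairs by blast
    show "?a \<le> p ^ card A" if "A \<in> pairs ` \<S>" for A
      using that ce by auto
    show "?a / 2 \<le> ?a" using p by simp
  qed (rule main)
  also have "card (pairs ` \<S>) = card \<S>" by (rule card_image[OF inj])
  finally show ?thesis by (simp add: field_simps)
qed

section \<open>Asymptotics at density of order n^(-2/k)\<close>

lemma real_choose_2: "real (j choose 2) = real j * (real j - 1) / 2"
proof -
  have "2 * (j choose 2) = j * (j - 1)"
    by (cases "even j") (auto simp: choose_two)
  then have "2 * real (j choose 2) = real j * real (j - 1)"
    by (metis of_nat_mult of_nat_numeral)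
  then show ?thesis by (cases j) auto
qed

lemma powr_power_mult_power:
  fixes x :: real
  assumes "0 < x"
  shows "(x powr a) ^ m * x ^ l = x powr (a * real m + real l)"
proof -
  have "(x powr a) ^ m = x powr (a * real m)"
    using assms by (simp add: powr_powr flip: powr_realpow)
  then show ?thesis using assms by (simp only: powr_add powr_realpow)
qed

lemma overlap_bound_tendsto_0:
  assumes "2 \<le> k" "0 < C"
  shows "(\<lambda>n. overlap_bound k (C * real n powr (- 2 / real k)) n) \<longlonglongrightarrow> 0"
proof -
  have "(\<lambda>n. real n ^ (k - j) * (C * real n powr (- 2 / real k)) ^ ((k choose 2) - (j choose 2)))
      \<longlonglongrightarrow> 0" if j: "j \<in> {2..<k}" for j
  proof -
    define m where "m = (k choose 2) - (j choose 2)"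
    define b where "b = - ((real j - 1) * (real k - real j) / real k)"
    have b: "b < 0" using j assms by (simp add: b_def)
    have m: "real m = (real k * (real k - 1) - real j * (real j - 1)) / 2"
      using j binomial_right_mono[of j k 2] by (simp add: m_def of_nat_diff real_choose_2 field_simps)
    have exponent: "real (k - j) + - 2 / real k * real m = b"
      using j assms unfolding m b_def by (simp add: of_nat_diff field_simps)
    have "(\<lambda>n. C ^ m * real n powr b) \<longlonglongrightarrow> C ^ m * 0"
      by (intro tendsto_mult tendsto_const tendsto_neg_powr b filterlim_real_sequentially)
    moreover have "\<forall>\<^sub>F n in sequentially. C ^ m * real n powr b =
      real n ^ (k - j) * (C * real n powr (- 2 / real k)) ^ m"
      using eventually_gt_at_top[of 0]
    proof eventually_elim
      case (elim n)
      then have "real n ^ (k - j) * (real n powr (- 2 / real k)) ^ m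
        = real n powr (real (k - j) + - 2 / real k * real m)"
        using powr_power_mult_power[of "real n" "- 2 / real k" m "k - j"]
        by (simp add: add.commute mult.commute)
      then have "real n ^ (k - j) * (real n powr (- 2 / real k)) ^ m = real n powr b"
        unfolding exponent .
      then show ?case by (simp add: power_mult_distrib)
    qed
    ultimately show ?thesis unfolding m_def[symmetric]
      by (simp add: filterlim_cong)
  qed
  then have "(\<lambda>n. overlap_bound k (C * real n powr (- 2 / real k)) n) \<longlonglongrightarrow> 2 ^ k * (\<Sum>j\<in>{2..<k}. 0)"
    unfolding overlap_bound_def by (intro tendsto_mult tendsto_const tendsto_sum)
  then show ?thesis by simp
qed

text \<open>The origin of the exponent -2/k: since - (2/k) (k choose 2) + k = 1, a family of order
  n^k k-sets contains linearly many cliques in expectation.\<close>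

lemma expected_cliques:
  assumes "2 \<le> k" "0 < n"
  shows "(C * real n powr (- 2 / real k)) ^ (k choose 2) * real n ^ k = C ^ (k choose 2) * real n"
proof -
  have "(real n powr (- 2 / real k)) ^ (k choose 2) * real n ^ k
    = real n powr (- 2 / real k * real (k choose 2) + real k)"
    using assms by (intro powr_power_mult_power) simp
  also have "- 2 / real k * real (k choose 2) + real k = 1"
    using assms by (simp add: real_choose_2 field_simps)
  finally show ?thesis using assms by (simp add: power_mult_distrib)
qed

text \<open>The condition on C makes each Janson exponent at least (K + 1) n, so that exp(K n)
  families leave a failure probability of at most exp(-n).\<close>

lemma prob_family_without_clique_tendsto_0:
  fixes \<FF> :: "nat \<Rightarrow> nat set set set"
  assumes k: "2 \<le> k" and \<beta>: "0 < \<beta>"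
    and fam: "\<And>n \<S> S. \<S> \<in> \<FF> n \<Longrightarrow> S \<in> \<S> \<Longrightarrow> S \<subseteq> {0..<n} \<and> card S = k"
    and card: "\<forall>\<^sub>F n in sequentially. real (card (\<FF> n)) \<le> exp (K * real n)"
    and C: "1 \<le> C" "2 * (K + 1) / \<beta> \<le> C"
    and p: "\<forall>\<^sub>F n in sequentially. C * real n powr (- 2 / real k) \<le> 1"
  shows "(\<lambda>n. subset_prob (all_pairs n) (C * real n powr (- 2 / real k))
    (\<lambda>F. \<exists>\<S>\<in>\<FF> n. \<beta> * real n ^ k \<le> real (card \<S>) \<and> (\<forall>S\<in>\<S>. \<not> is_clique F S))) \<longlonglongrightarrow> 0"
proof (rule tendsto_sandwich[OF _ _ tendsto_const])
  let ?p = "\<lambda>n. C * real n powr (- 2 / real k)"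
  let ?X = "\<lambda>n. subset_prob (all_pairs n) (?p n)
    (\<lambda>F. \<exists>\<S>\<in>\<FF> n. \<beta> * real n ^ k \<le> real (card \<S>) \<and> (\<forall>S\<in>\<S>. \<not> is_clique F S))"
  have p0: "0 \<le> ?p n" for n using C by simp
  show "\<forall>\<^sub>F n in sequentially. 0 \<le> ?X n"
    using p by eventually_elim (rule subset_prob_nonneg[OF p0])
  have "\<forall>\<^sub>F n in sequentially. overlap_bound k (?p n) n < 1 / 2"
    using overlap_bound_tendsto_0[OF k, of C] C by (intro order_tendstoD) auto
  then show "\<forall>\<^sub>F n in sequentially. ?X n \<le> exp (- real n)"
    using p card eventually_gt_at_top[of 0]
  proof eventually_elim
    case (elim n)
    let ?I = "{\<S>\<in>\<FF> n. \<beta> * real n ^ k \<le> real (card \<S>)}"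
    have finF: "finite (\<FF> n)"
    proof (rule finite_subset)
      show "\<FF> n \<subseteq> Pow (Pow {0..<n})" using fam by blast
    qed simp
    have fin: "finite ?I" using finF by simp
    have each: "subset_prob (all_pairs n) (?p n) (\<lambda>F. \<forall>S\<in>\<S>. \<not> is_clique F S) \<le> exp (- ((K + 1) * real n))"
      if "\<S> \<in> ?I" for \<S>
    proof -
      have \<S>: "\<S> \<in> \<FF> n" "\<beta> * real n ^ k \<le> real (card \<S>)" using that by auto
      \<comment> \<open>As C is at least 1 and the exponent is positive, C is at most its power; a
        bound on C itself is then enough.\<close>
      have "k choose 2 > 0" using k by simp
      then have "C \<le> C ^ (k choose 2)" using C(1) self_le_power by blast
      then have "2 * (K + 1) \<le> \<beta> * C ^ (k choose 2)"
      proof -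
        have "2 * (K + 1) \<le> \<beta> * C" using C(2) \<beta> by (simp add: field_simps)
        also have "\<dots> \<le> \<beta> * C ^ (k choose 2)"
          using \<open>C \<le> C ^ (k choose 2)\<close> \<beta> by (intro mult_left_mono) auto
        finally show ?thesis .
      qed
      then have "2 * (K + 1) * real n \<le> \<beta> * C ^ (k choose 2) * real n"
        by (intro mult_right_mono) auto
      also have "\<dots> = ?p n ^ (k choose 2) * (\<beta> * real n ^ k)"
        unfolding mult.left_commute[of _ \<beta>] expected_cliques[OF k elim(4), of C]
        by (rule mult.assoc)
      also have "\<dots> \<le> ?p n ^ (k choose 2) * real (card \<S>)"
        using \<S>(2) p0 by (intro mult_left_mono) auto
      finally have "(K + 1) * real n \<le> ?p n ^ (k choose 2) * real (card \<S>) / 2" by argo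
      moreover have "subset_prob (all_pairs n) (?p n) (\<lambda>F. \<forall>S\<in>\<S>. \<not> is_clique F S)
        \<le> exp (- (?p n ^ (k choose 2) * real (card \<S>) / 2))"
        by (rule prob_no_clique_le[OF p0 elim(2) k fam[OF \<S>(1)] less_imp_le[OF elim(1)]])
      moreover have "exp (- (?p n ^ (k choose 2) * real (card \<S>) / 2)) \<le> exp (- ((K + 1) * real n))"
        using calculation(1) by (simp only: exp_le_cancel_iff neg_le_iff_le)
      ultimately show ?thesis by linarith
    qed
    have "?X n = subset_prob (all_pairs n) (?p n) (\<lambda>F. \<exists>\<S>\<in>?I. \<forall>S\<in>\<S>. \<not> is_clique F S)"
      by (rule subset_prob_cong) auto
    also have "\<dots> \<le> (\<Sum>\<S>\<in>?I. subset_prob (all_pairs n) (?p n) (\<lambda>F. \<forall>S\<in>\<S>. \<not> is_clique F S))"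
      by (rule subset_prob_ex_le_sum[OF p0 elim(2) fin])
    also have "\<dots> \<le> real (card ?I) * exp (- ((K + 1) * real n))"
      by (rule sum_bounded_above) (rule each)
    also have "\<dots> \<le> exp (K * real n) * exp (- ((K + 1) * real n))"
    proof (rule mult_right_mono)
      have "card ?I \<le> card (\<FF> n)" by (rule card_mono[OF finF]) auto
      then show "real (card ?I) \<le> exp (K * real n)" using elim(3) by linarith
    qed simp
    also have "\<dots> = exp (- real n)" by (simp add: exp_add[symmetric] algebra_simps)
    finally show ?case .
  qed
  show "(\<lambda>n. exp (- real n)) \<longlonglongrightarrow> 0"
    by (rule filterlim_compose[OF exp_at_bot])
      (simp add: filterlim_uminus_at_bot filterlim_real_sequentially)
qed

section \<open>Blowing up dense families of cliques\<close>

definition nbrs :: "nat set set \<Rightarrow> nat set \<Rightarrow> nat set" where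
  "nbrs G S = {v. \<forall>u\<in>S. {u, v} \<in> G}"

lemma subset_nbrs_iff: "A \<subseteq> nbrs G S \<longleftrightarrow> (\<forall>x\<in>S. A \<subseteq> nbrs G {x})"
  by (auto simp: nbrs_def)

text \<open>Transversal cliques are kept as lists so that their number compares directly with n^q,
  and so that fixing the first vertex leaves the same problem for the later sets cut down by
  \<open>restrict_nbrs\<close>.\<close>

fun cliques :: "nat set set \<Rightarrow> nat set list \<Rightarrow> nat list set" where
  "cliques G [] = {[]}"
| "cliques G (Z # Zs) =
    (\<lambda>(x, t). x # t) ` {(x, t). x \<in> Z \<and> t \<in> cliques G Zs \<and> set t \<subseteq> nbrs G {x}}"

abbreviation restrict_nbrs :: "nat set set \<Rightarrow> nat set \<Rightarrow> nat set list \<Rightarrow> nat set list" where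
  "restrict_nbrs G S Zs \<equiv> map (\<lambda>Z. Z \<inter> nbrs G S) Zs"

lemma cliques_restrict:
  "cliques G (restrict_nbrs G S Zs) = {t \<in> cliques G Zs. set t \<subseteq> nbrs G S}"
  by (induction Zs) auto

lemma cliques_subset_lists:
  assumes "set Zs \<subseteq> Pow V"
  shows "cliques G Zs \<subseteq> {t. set t \<subseteq> V \<and> length t = length Zs}"
  using assms
proof (induction Zs)
  case (Cons Z Zs)
  then have "cliques G Zs \<subseteq> {t. set t \<subseteq> V \<and> length t = length Zs}" "Z \<subseteq> V" by auto
  then show ?case by fastforce
qed simp

lemma
  assumes "finite V" "set Zs \<subseteq> Pow V"
  shows finite_cliques: "finite (cliques G Zs)"
    and card_cliques_le: "card (cliques G Zs) \<le> card V ^ length Zs"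
proof -
  show "finite (cliques G Zs)"
    using cliques_subset_lists[OF assms(2)] finite_lists_length_eq[OF assms(1)]
    by (rule finite_subset)
  show "card (cliques G Zs) \<le> card V ^ length Zs"
    using card_mono[OF finite_lists_length_eq[OF assms(1)] cliques_subset_lists[OF assms(2)]]
    by (simp add: card_lists_length_eq[OF assms(1)])
qed

lemma card_cliques_Cons:
  "card (cliques G (Z # Zs)) = card {(x, t). x \<in> Z \<and> t \<in> cliques G Zs \<and> set t \<subseteq> nbrs G {x}}"
  by (simp, rule card_image) (auto simp: inj_on_def)

lemma card_cliques_Cons_heads:
  assumes "finite Z" "finite (cliques G Zs)"
  shows "card (cliques G (Z # Zs)) = (\<Sum>x\<in>Z. card (cliques G (restrict_nbrs G {x} Zs)))"
proof -
  have "{(x, t). x \<in> Z \<and> t \<in> cliques G Zs \<and> set t \<subseteq> nbrs G {x}}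
    = (SIGMA x:Z. cliques G (restrict_nbrs G {x} Zs))"
    by (auto simp: cliques_restrict)
  then show ?thesis
    unfolding card_cliques_Cons using assms by (simp add: cliques_restrict)
qed

text \<open>Grouping by tails exhibits, for each tail, the vertices that extend it, among which
  k-sets can be chosen. Grouping by heads serves the greedy count in
  \<open>card_cliques_ge\<close>.\<close>

lemma card_cliques_Cons_tails:
  assumes "finite Z" "finite (cliques G Zs)"
  shows "card (cliques G (Z # Zs)) = (\<Sum>t\<in>cliques G Zs. card {x \<in> Z. set t \<subseteq> nbrs G {x}})"
proof -
  have "{(x, t). x \<in> Z \<and> t \<in> cliques G Zs \<and> set t \<subseteq> nbrs G {x}}
    = prod.swap ` (SIGMA t:cliques G Zs. {x \<in> Z. set t \<subseteq> nbrs G {x}})"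
    by auto
  then show ?thesis
    unfolding card_cliques_Cons using assms by (simp add: card_image)
qed

text \<open>Elements of value below \<open>c / 2 * N\<close> account for at most half of the assumed
  sum, and each other element for at most N. M and N are mere upper bounds, so powers of n can be
  inserted for them.\<close>

lemma card_ge_half_average:
  fixes f :: "'a \<Rightarrow> real"
  assumes "finite A" "real (card A) \<le> M" "\<And>a. a \<in> A \<Longrightarrow> f a \<le> N" "0 < N" "0 \<le> c"
    and sum: "c * M * N \<le> sum f A"
  shows "c / 2 * M \<le> real (card {a \<in> A. c / 2 * N \<le> f a})"
proof -
  let ?B = "{a \<in> A. c / 2 * N \<le> f a}"
  have "sum f A = sum f ?B + sum f (A - ?B)"
    using assms(1) by (metis (no_types, lifting) add.commute mem_Collect_eq subsetI sum.subset_diff)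
  also have "sum f ?B \<le> real (card ?B) * N"
    by (rule sum_bounded_above) (use assms(3) in auto)
  also have "sum f (A - ?B) \<le> real (card (A - ?B)) * (c / 2 * N)"
    by (rule sum_bounded_above) auto
  also have "\<dots> \<le> M * (c / 2 * N)"
  proof (rule mult_right_mono)
    have "card (A - ?B) \<le> card A" using assms(1) by (intro card_mono) auto
    then show "real (card (A - ?B)) \<le> M" using assms(2) by linarith
  qed (use assms in auto)
  finally have "(c / 2 * M) * N \<le> real (card ?B) * N" using sum by (simp add: algebra_simps)
  then show ?thesis using assms(4) by simp
qed

text \<open>One factor \<open>c / 2\<close> is the density of tails with many extensions,
  \<open>(c / 2) ^ k / k ^ k\<close> bounds the k-subsets of such an extension set, and the last
  half is lost in averaging over k-sets.\<close>

definition supersat :: "nat \<Rightarrow> real \<Rightarrow> real" where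
  "supersat k c = (c / 2) ^ Suc k / real k ^ k / 2"

text \<open>A \<open>k\<close>-set of first coordinates is extended by a tuple \<open>t\<close> exactly if it lies in the
  set of \<open>d(t)\<close> vertices extending \<open>t\<close>, so we count pairs by summing \<open>d(t) choose k\<close>.\<close>

lemma many_extensible_sets:
  assumes k: "0 < k" and c: "0 < c" and n: "real k \<le> c / 2 * real n"
    and Z: "Z \<subseteq> {0..<n}" "set Zs \<subseteq> Pow {0..<n}"
    and dense: "c * real n ^ Suc (length Zs) \<le> real (card (cliques G (Z # Zs)))"
  shows "supersat k c * real n ^ k \<le>
    real (card {S. S \<subseteq> Z \<and> card S = k \<and>
      supersat k c * real n ^ length Zs \<le> real (card (cliques G (restrict_nbrs G S Zs)))})"
proof -
  let ?q = "length Zs"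
  define D where "D t = {x \<in> Z. set t \<subseteq> nbrs G {x}}" for t
  define \<S> where "\<S> = {S. S \<subseteq> Z \<and> card S = k}"
  let ?T = "{t \<in> cliques G Zs. c / 2 * real n \<le> real (card (D t))}"
  have finZ: "finite Z" using Z(1) finite_subset by blast
  have fin: "finite (cliques G Zs)" using Z(2) by (intro finite_cliques) auto
  have fin\<S>: "finite \<S>" using finZ by (simp add: \<S>_def)
  have n0: "0 < n" using n k c by (cases n) auto
  have card_cl: "real (card (cliques G Zs)) \<le> real n ^ ?q"
    using card_cliques_le[of "{0..<n}" Zs G] Z(2) by (simp flip: of_nat_power)
  have D: "D t \<subseteq> Z" "finite (D t)" for t using finZ by (auto simp: D_def)
  have cardZ: "card A \<le> n" if "A \<subseteq> Z" for A
    using card_mono[of "{0..<n}" A] that Z(1) by simp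
  \<comment> \<open>First averaging, over tails: many of them extend to at least
    \<open>c / 2 * n\<close> vertices of \<open>Z\<close>, which is at least k by
    assumption.\<close>
  have T: "c / 2 * real n ^ ?q \<le> real (card ?T)"
  proof (rule card_ge_half_average[OF fin card_cl])
    show "real (card (D t)) \<le> real n" for t using cardZ[OF D(1)] by simp
    show "c * real n ^ ?q * real n \<le> (\<Sum>t\<in>cliques G Zs. real (card (D t)))"
      using dense unfolding card_cliques_Cons_tails[OF finZ fin] D_def by (simp add: mult_ac)
  qed (use n0 c in auto)
  have "(\<Sum>S\<in>\<S>. real (card (cliques G (restrict_nbrs G S Zs))))
    = (\<Sum>S\<in>\<S>. \<Sum>t\<in>{t \<in> cliques G Zs. S \<subseteq> D t}. 1)"
  proof (rule sum.cong)
    fix S assume "S \<in> \<S>"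
    then have "cliques G (restrict_nbrs G S Zs) = {t \<in> cliques G Zs. S \<subseteq> D t}"
      unfolding cliques_restrict subset_nbrs_iff[of _ G S] by (auto simp: \<S>_def D_def)
    then show "real (card (cliques G (restrict_nbrs G S Zs))) = (\<Sum>t\<in>{t \<in> cliques G Zs. S \<subseteq> D t}. 1)"
      by simp
  qed simp
  also have "\<dots> = (\<Sum>t\<in>cliques G Zs. \<Sum>S\<in>{S \<in> \<S>. S \<subseteq> D t}. 1)"
    by (rule sum.swap_restrict[OF fin\<S> fin])
  also have "\<dots> = (\<Sum>t\<in>cliques G Zs. real (card (D t) choose k))"
  proof (rule sum.cong)
    fix t assume "t \<in> cliques G Zs"
    have "{S \<in> \<S>. S \<subseteq> D t} = {S. S \<subseteq> D t \<and> card S = k}"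
      using D(1) by (auto simp: \<S>_def)
    then show "(\<Sum>S\<in>{S \<in> \<S>. S \<subseteq> D t}. 1) = real (card (D t) choose k)"
      using n_subsets[OF D(2), of t k] by simp
  qed simp
  also have "\<dots> \<ge> (\<Sum>t\<in>?T. real (card (D t) choose k))"
    by (rule sum_mono2) (use fin in auto)
  finally have "(\<Sum>t\<in>?T. real (card (D t) choose k)) \<le>
    (\<Sum>S\<in>\<S>. real (card (cliques G (restrict_nbrs G S Zs))))" .
  moreover have "real (card ?T) * (c / 2 * real n / real k) ^ k \<le> (\<Sum>t\<in>?T. real (card (D t) choose k))"
  proof (rule sum_bounded_below)
    fix t assume "t \<in> ?T"
    then have t: "c / 2 * real n \<le> real (card (D t))" by simp
    then have "k \<le> card (D t)" using n by linarith
    then have "(real (card (D t)) / real k) ^ k \<le> real (card (D t) choose k)"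
      by (rule binomial_ge_n_over_k_pow_k)
    moreover have "(c / 2 * real n / real k) ^ k \<le> (real (card (D t)) / real k) ^ k"
      by (intro power_mono divide_right_mono t) (use c in auto)
    ultimately show "(c / 2 * real n / real k) ^ k \<le> real (card (D t) choose k)" by linarith
  qed
  moreover have "(c / 2 * real n ^ ?q) * (c / 2 * real n / real k) ^ k
      \<le> real (card ?T) * (c / 2 * real n / real k) ^ k"
    by (rule mult_right_mono[OF T]) (use c in auto)
  moreover have "(c / 2 * real n ^ ?q) * (c / 2 * real n / real k) ^ k
      = (2 * supersat k c) * real n ^ k * real n ^ ?q"
    by (simp add: supersat_def power_mult_distrib power_divide mult_ac)
  ultimately have sum: "(2 * supersat k c) * real n ^ k * real n ^ ?q
      \<le> (\<Sum>S\<in>\<S>. real (card (cliques G (restrict_nbrs G S Zs))))" by linarith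
  \<comment> \<open>Second averaging, over k-sets; the factor 2 is kept visible to match the half in
    \<open>card_ge_half_average\<close>.\<close>
  have "2 * supersat k c / 2 * real n ^ k \<le>
    real (card {S \<in> \<S>. 2 * supersat k c / 2 * real n ^ ?q \<le> real (card (cliques G (restrict_nbrs G S Zs)))})"
  proof (rule card_ge_half_average[OF fin\<S> _ _ _ _ sum])
    have "card \<S> = card Z choose k" unfolding \<S>_def by (rule n_subsets[OF finZ])
    also have "\<dots> \<le> n choose k" by (rule binomial_right_mono) (rule cardZ[OF subset_refl])
    also have "\<dots> \<le> n ^ k" by (rule binomial_le_power)
    finally show "real (card \<S>) \<le> real n ^ k" by (simp flip: of_nat_power)
    show "real (card (cliques G (restrict_nbrs G S Zs))) \<le> real n ^ ?q" for S
    proof -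
      have "card (cliques G (restrict_nbrs G S Zs)) \<le> card (cliques G Zs)"
        unfolding cliques_restrict using fin by (intro card_mono) auto
      then show ?thesis using card_cl by linarith
    qed
  qed (use n0 c in \<open>auto simp: supersat_def\<close>)
  then show ?thesis by (simp add: \<S>_def)
qed

section \<open>Families of extensible k-sets and their number\<close>

definition extensible_sets :: "nat set set \<Rightarrow> nat \<Rightarrow> nat set \<times> nat set list \<times> nat \<Rightarrow> nat set set" where
  "extensible_sets G k = (\<lambda>(Z, Zs, \<theta>).
     {S. S \<subseteq> Z \<and> card S = k \<and> \<theta> \<le> card (cliques G (restrict_nbrs G S Zs))})"

text \<open>Depends on G but not on the random graph, as the union bound requires. Integer
  thresholds up to n^q make the index set finite without losing any case, because clique counts are
  integers of at most this size.\<close>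

definition extensible_family :: "nat set set \<Rightarrow> nat \<Rightarrow> nat \<Rightarrow> nat \<Rightarrow> nat set set set" where
  "extensible_family G k q n = extensible_sets G k `
     (Pow {0..<n} \<times> {Zs. set Zs \<subseteq> Pow {0..<n} \<and> length Zs \<le> q} \<times> {..n ^ q})"

lemma extensible_family_members:
  assumes "\<S> \<in> extensible_family G k q n" "S \<in> \<S>"
  shows "S \<subseteq> {0..<n} \<and> card S = k"
  using assms by (auto simp: extensible_family_def extensible_sets_def)

lemma two_power_le_exp: "2 ^ m \<le> exp (real m)"
proof -
  have "(2::real) ^ m \<le> exp 1 ^ m"
    using exp_ge_add_one_self[of "1::real"] by (intro power_mono) auto
  then show ?thesis by (simp flip: exp_of_nat_mult)
qed

text \<open>In powers of 2^n, the set \<open>Z\<close> contributes 1, the lists 2q and the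
  thresholds q + 1.\<close>

lemma card_extensible_family_le:
  assumes "0 < n"
  shows "real (card (extensible_family G k q n)) \<le> exp (real (3 * q + 2) * real n)"
proof -
  let ?L = "{Zs. set Zs \<subseteq> Pow {0..<n} \<and> length Zs \<le> q}"
  have finL: "finite ?L" by (rule finite_lists_length_le) simp
  have "card ?L = (\<Sum>i\<le>q. (2 ^ n) ^ i)"
    using card_lists_length_le[of "Pow {0..<n}" q] by (simp add: card_Pow)
  also have "\<dots> \<le> (\<Sum>i\<le>q. (2 ^ n) ^ q)"
    by (intro sum_mono power_increasing) auto
  also have "\<dots> = (q + 1) * 2 ^ (n * q)" by (simp add: power_mult)
  also have "\<dots> \<le> 2 ^ (n * q) * 2 ^ (n * q)"
  proof (rule mult_right_mono)
    have "q + 1 \<le> 2 ^ q" using Suc_leI[OF less_exp[of q]] by simp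
    also have "(2::nat) ^ q \<le> 2 ^ (n * q)" using assms by (intro power_increasing) auto
    finally show "q + 1 \<le> 2 ^ (n * q)" .
  qed simp
  finally have L: "card ?L \<le> 2 ^ (n * q + n * q)" by (simp add: power_add)
  have "n ^ q + 1 \<le> 2 ^ (n * q) + 2 ^ (n * q)"
  proof (rule add_mono)
    show "n ^ q \<le> 2 ^ (n * q)"
      unfolding power_mult by (rule power_mono) (use less_exp[of n] in simp_all)
  qed simp
  also have "\<dots> = 2 ^ (n * q) * 2" by simp
  also have "\<dots> \<le> 2 ^ (n * q) * 2 ^ n"
    using self_le_power[of "2::nat" n] assms by (intro mult_le_mono2) simp
  finally have \<theta>: "card {..n ^ q} \<le> 2 ^ (n * q + n)" by (simp add: power_add)
  have "card (extensible_family G k q n) \<le> card (Pow {0..<n} \<times> ?L \<times> {..n ^ q})"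
    unfolding extensible_family_def by (rule card_image_le) (use finL in auto)
  also have "\<dots> = 2 ^ n * (card ?L * card {..n ^ q})"
    by (simp only: card_cartesian_product card_Pow finite_atLeastLessThan card_atLeastLessThan diff_zero)
  also have "\<dots> \<le> 2 ^ n * (2 ^ (n * q + n * q) * 2 ^ (n * q + n))"
    by (intro mult_le_mono L \<theta> order_refl)
  also have "\<dots> = 2 ^ ((3 * q + 2) * n)"
    by (simp add: algebra_simps flip: power_add)
  finally have "real (card (extensible_family G k q n)) \<le> real (2 ^ ((3 * q + 2) * n))"
    by (rule of_nat_mono)
  also have "\<dots> \<le> exp (real ((3 * q + 2) * n))"
    using two_power_le_exp[of "(3 * q + 2) * n"] by simp
  finally show ?thesis by (simp only: of_nat_mult)
qed

text \<open>The only property of the random graph that the tiling uses. It holds for all families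
  simultaneously and so for sets chosen in dependence on F.\<close>

definition hits_extensible :: "nat set set \<Rightarrow> nat \<Rightarrow> nat \<Rightarrow> real \<Rightarrow> nat \<Rightarrow> nat set set \<Rightarrow> bool" where
  "hits_extensible G k q \<beta> n F \<longleftrightarrow>
    (\<forall>\<S>\<in>extensible_family G k q n. \<beta> * real n ^ k \<le> real (card \<S>) \<longrightarrow> (\<exists>S\<in>\<S>. is_clique F S))"

lemma hits_extensible_mono:
  assumes "hits_extensible G k q \<beta> n F" "\<beta> \<le> \<beta>'"
  shows "hits_extensible G k q \<beta>' n F"
  unfolding hits_extensible_def
proof (intro ballI impI)
  fix \<S> assume *: "\<S> \<in> extensible_family G k q n" "\<beta>' * real n ^ k \<le> real (card \<S>)"
  have "\<beta> * real n ^ k \<le> \<beta>' * real n ^ k" by (intro mult_right_mono assms(2)) simp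
  then show "\<exists>S\<in>\<S>. is_clique F S" using assms(1) * unfolding hits_extensible_def by auto
qed

section \<open>Blow-ups whose parts are cliques of the random graph\<close>

definition joined_blobs :: "nat set set \<Rightarrow> nat set set \<Rightarrow> nat \<Rightarrow> nat set list \<Rightarrow> nat set list \<Rightarrow> bool" where
  "joined_blobs G F k Zs Qs \<longleftrightarrow> length Qs = length Zs \<and>
     (\<forall>i<length Zs. Qs ! i \<subseteq> Zs ! i \<and> card (Qs ! i) = k \<and> is_clique F (Qs ! i)) \<and>
     (\<forall>j<length Zs. \<forall>i<j. Qs ! j \<subseteq> nbrs G (Qs ! i))"

lemma joined_blobs_Cons:
  assumes "S \<subseteq> Z" "card S = k" "is_clique F S" "joined_blobs G F k (restrict_nbrs G S Zs) Qs"
  shows "joined_blobs G F k (Z # Zs) (S # Qs)"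
  unfolding joined_blobs_def
proof (intro conjI allI impI)
  show "length (S # Qs) = length (Z # Zs)" using assms(4) by (simp add: joined_blobs_def)
next
  fix i assume "i < length (Z # Zs)"
  then show "(S # Qs) ! i \<subseteq> (Z # Zs) ! i" "card ((S # Qs) ! i) = k" "is_clique F ((S # Qs) ! i)"
    using assms by (cases i; force simp: joined_blobs_def)+
next
  fix j i assume *: "j < length (Z # Zs)" "i < j"
  then obtain j' where j': "j = Suc j'" "j' < length Zs" by (cases j) auto
  show "(S # Qs) ! j \<subseteq> nbrs G ((S # Qs) ! i)"
  proof (cases i)
    case 0
    have "Qs ! j' \<subseteq> restrict_nbrs G S Zs ! j'"
      using assms(4) j'(2) unfolding joined_blobs_def by simp
    then show ?thesis using 0 j' by simp
  next
    case (Suc i')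
    then show ?thesis using assms(4) j' *(2) unfolding joined_blobs_def by simp
  qed
qed

text \<open>Induction on the number of parts: the k-subsets of the first part with many extensions
  form a large extensible family, F has a clique among them, and the other parts shrink to its
  common neighbourhood while staying dense. The fixed bound \<open>Q\<close> lets one hypothesis on
  F serve every stage.\<close>

lemma dense_cliques_imp_joined_blobs:
  assumes k: "0 < k"
  shows "0 < c \<Longrightarrow> \<exists>\<beta>>0. \<exists>N. \<forall>n\<ge>N. \<forall>G F Zs.
    length Zs = q \<longrightarrow> set Zs \<subseteq> Pow {0..<n} \<longrightarrow> q \<le> Q \<longrightarrow>
    c * real n ^ q \<le> real (card (cliques G Zs)) \<longrightarrow> hits_extensible G k Q \<beta> n F \<longrightarrow>
    (\<exists>Qs. joined_blobs G F k Zs Qs)"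
proof (induction q arbitrary: c)
  case 0
  show ?case by (rule exI[of _ 1]) (auto simp: joined_blobs_def)
next
  case (Suc q)
  let ?c = "supersat k c"
  have c1: "0 < ?c" using Suc.prems k by (simp add: supersat_def)
  obtain \<beta> N where \<beta>: "0 < \<beta>" and IH: "\<And>n G F Zs. N \<le> n \<Longrightarrow>
      length Zs = q \<Longrightarrow> set Zs \<subseteq> Pow {0..<n} \<Longrightarrow> q \<le> Q \<Longrightarrow>
      ?c * real n ^ q \<le> real (card (cliques G Zs)) \<Longrightarrow> hits_extensible G k Q \<beta> n F \<Longrightarrow>
      \<exists>Qs. joined_blobs G F k Zs Qs"
    using Suc.IH[OF c1] by blast
  obtain M :: nat where M: "2 * real k / c \<le> real M" using real_arch_simple by blast
  show ?case
  proof (intro exI[of _ "min \<beta> ?c"] conjI exI[of _ "max (max N M) 1"] allI impI)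
    show "0 < min \<beta> ?c" using \<beta> c1 by simp
  next
    fix n G F and Zs :: "nat set list"
    assume n: "max (max N M) 1 \<le> n" and Zs: "length Zs = Suc q" "set Zs \<subseteq> Pow {0..<n}" "Suc q \<le> Q"
      and dense: "c * real n ^ Suc q \<le> real (card (cliques G Zs))"
      and hits: "hits_extensible G k Q (min \<beta> ?c) n F"
    obtain Z Ws where ZW: "Zs = Z # Ws" using Zs(1) by (cases Zs) auto
    have Ws: "length Ws = q" "set Ws \<subseteq> Pow {0..<n}" "Z \<subseteq> {0..<n}" using Zs ZW by auto
    have "2 * real k / c \<le> real n" using M n by linarith
    then have "real k \<le> c / 2 * real n" using Suc.prems by (simp add: field_simps)
    note many = many_extensible_sets[OF k Suc.prems this Ws(3,2), of G]
    define \<theta> where "\<theta> = nat \<lceil>?c * real n ^ q\<rceil>"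
    define \<S> where "\<S> = extensible_sets G k (Z, Ws, \<theta>)"
    have "{S. S \<subseteq> Z \<and> card S = k \<and>
        ?c * real n ^ q \<le> real (card (cliques G (restrict_nbrs G S Ws)))} = \<S>"
      by (simp add: \<S>_def extensible_sets_def \<theta>_def nat_le_iff ceiling_le_iff)
    then have card\<S>: "?c * real n ^ k \<le> real (card \<S>)"
      using many dense unfolding ZW Ws(1) by simp
    \<comment> \<open>Some member of the family is inspected here only to see that
      \<open>\<theta>\<close> is at most \<open>n ^ Q\<close>, as membership in
      \<open>extensible_family\<close> demands; the clique of F is chosen afterwards.\<close>
    have "0 < ?c * real n ^ k" using c1 n by simp
    then have "\<S> \<noteq> {}" using card\<S> by auto
    then obtain S where "S \<in> \<S>" by blast
    then have "\<theta> \<le> card (cliques G (restrict_nbrs G S Ws))"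
      by (simp add: \<S>_def extensible_sets_def)
    also have "\<dots> \<le> card {0..<n} ^ length (restrict_nbrs G S Ws)"
      by (rule card_cliques_le) (use Ws(2) in auto)
    also have "\<dots> \<le> n ^ Q" using Ws(1) Zs(3) n by (simp add: power_increasing)
    finally have "\<theta> \<le> n ^ Q" .
    then have "\<S> \<in> extensible_family G k Q n"
      unfolding \<S>_def extensible_family_def using Ws Zs(3) by (intro imageI) simp
    moreover have "min \<beta> ?c * real n ^ k \<le> real (card \<S>)"
      using card\<S> mult_right_mono[of "min \<beta> ?c" ?c "real n ^ k"] by simp
    ultimately obtain S where S: "S \<in> \<S>" "is_clique F S"
      using hits unfolding hits_extensible_def by blast
    have S': "S \<subseteq> Z" "card S = k" "\<theta> \<le> card (cliques G (restrict_nbrs G S Ws))"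
      using S(1) by (simp_all add: \<S>_def extensible_sets_def)
    have "\<exists>Qs. joined_blobs G F k (restrict_nbrs G S Ws) Qs"
    proof (rule IH)
      show "N \<le> n" using n by simp
      show "?c * real n ^ q \<le> real (card (cliques G (restrict_nbrs G S Ws)))"
        using S'(3) by (simp add: \<theta>_def nat_le_iff ceiling_le_iff)
      show "hits_extensible G k Q \<beta> n F" by (rule hits_extensible_mono[OF hits]) simp
      show "set (restrict_nbrs G S Ws) \<subseteq> Pow {0..<n}" using Ws(2) by auto
    qed (use Ws(1) Zs(3) in auto)
    then obtain Qs where "joined_blobs G F k (restrict_nbrs G S Ws) Qs" by blast
    then show "\<exists>Qs. joined_blobs G F k Zs Qs"
      using joined_blobs_Cons[OF S'(1,2) S(2)] unfolding ZW by blast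
  qed
qed

section \<open>Quantiles and transversal cliques\<close>

text \<open>The largest attained value whose upper level set is big enough. Because of ties, weak
  and strict level sets need separate bounds.\<close>

lemma quantile_exists:
  fixes y :: "'a \<Rightarrow> real"
  assumes "finite U" "U \<noteq> {}" "0 < a" "a \<le> 1"
  shows "\<exists>\<tau>. a * real (card U) \<le> real (card {v \<in> U. \<tau> \<le> y v}) \<and>
    real (card {v \<in> U. \<tau> < y v}) < a * real (card U)"
proof -
  define W where "W = {v \<in> U. a * real (card U) \<le> real (card {w \<in> U. y v \<le> y w})}"
  define \<tau> where "\<tau> = Max (y ` W)"
  have U0: "0 < real (card U)" using assms by (simp add: card_gt_0_iff)
  have finW: "finite W" using assms(1) by (simp add: W_def)
  obtain v0 where v0: "v0 \<in> U" "\<And>w. w \<in> U \<Longrightarrow> y v0 \<le> y w"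
    using ex_is_arg_min_if_finite[OF assms(1,2), of y]
    by (auto simp: is_arg_min_def not_less)
  have "{w \<in> U. y v0 \<le> y w} = U" using v0 by auto
  moreover have "a * real (card U) \<le> 1 * real (card U)" by (intro mult_right_mono assms) simp
  ultimately have "v0 \<in> W" using v0 by (simp add: W_def)
  then have "\<tau> \<in> y ` W" unfolding \<tau>_def using finW by (intro Max_in) auto
  then have 1: "a * real (card U) \<le> real (card {v \<in> U. \<tau> \<le> y v})"
    by (auto simp: W_def)
  have 2: "real (card {v \<in> U. \<tau> < y v}) < a * real (card U)"
  proof (cases "{v \<in> U. \<tau> < y v} = {}")
    case True
    then have "card {v \<in> U. \<tau> < y v} = 0" by (metis card.empty)
    then show ?thesis using assms(3) U0 by simp
  next
    case False
    obtain w where "is_arg_min y (\<lambda>v. v \<in> {v \<in> U. \<tau> < y v}) w"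
      using ex_is_arg_min_if_finite[OF _ False, of y] assms(1) by auto
    then have w: "w \<in> U" "\<tau> < y w" "\<And>v. v \<in> U \<Longrightarrow> \<tau> < y v \<Longrightarrow> y w \<le> y v"
      by (auto simp: is_arg_min_linorder)
    have "w \<notin> W"
    proof
      assume "w \<in> W"
      then have "y w \<le> \<tau>" unfolding \<tau>_def using finW by (intro Max_ge) auto
      then show False using w(2) by simp
    qed
    moreover have "{v \<in> U. y w \<le> y v} = {v \<in> U. \<tau> < y v}"
      using w by force
    ultimately show ?thesis using w(1) by (simp add: W_def not_le)
  qed
  from 1 2 show ?thesis by blast
qed

lemma quantile_antimono:
  fixes y :: "'a \<Rightarrow> real"
  assumes "finite U" "a \<le> b"
    and "real (card {v \<in> U. \<sigma> < y v}) < a * real (card U)"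
    and "b * real (card U) \<le> real (card {v \<in> U. \<tau> \<le> y v})"
  shows "\<tau> \<le> \<sigma>"
proof (rule ccontr)
  assume "\<not> \<tau> \<le> \<sigma>"
  then have "card {v \<in> U. \<tau> \<le> y v} \<le> card {v \<in> U. \<sigma> < y v}"
    by (intro card_mono) (use assms(1) in auto)
  moreover have "a * real (card U) \<le> b * real (card U)"
    by (intro mult_right_mono assms(2)) simp
  ultimately show False using assms(3,4) by linarith
qed

text \<open>By telescoping, the right-hand side is \<open>z\<close> rounded up to the next
  threshold, or \<open>t j\<close> if \<open>z\<close> lies below all of them.\<close>

lemma le_layers:
  fixes t :: "nat \<Rightarrow> real"
  assumes "\<And>i. i < j \<Longrightarrow> t (Suc i) \<le> t i" "z \<le> t 0"
  shows "z \<le> t j + (\<Sum>i<j. (t i - t (Suc i)) * of_bool (t (Suc i) < z))"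
  using assms(1)
proof (induction j)
  case 0
  show ?case using assms(2) by simp
next
  case (Suc j)
  let ?s = "\<lambda>j. \<Sum>i<j. (t i - t (Suc i)) * of_bool (t (Suc i) < z)"
  have IH: "z \<le> t j + ?s j" using Suc by simp
  have "0 \<le> ?s (Suc j)"
    by (rule sum_nonneg) (use Suc.prems in simp)
  then show ?case using IH by (cases "t (Suc j) < z") auto
qed

text \<open>Summation by parts: consecutive weights \<open>real i * \<kappa> + \<eta>\<close> differ
  by \<open>\<kappa>\<close>, so all intermediate thresholds get the same coefficient.\<close>

lemma abel_sum_layers:
  fixes t :: "nat \<Rightarrow> real"
  shows "t (Suc j) + (\<Sum>i<Suc j. (t i - t (Suc i)) * (real i * \<kappa> + \<eta>)) =
    t 0 * \<eta> + \<kappa> * (\<Sum>i<j. t (Suc i)) + (1 - (real j * \<kappa> + \<eta>)) * t (Suc j)"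
proof (induction j)
  case 0
  show ?case by (simp add: algebra_simps)
next
  case (Suc j)
  then show ?case by (simp add: algebra_simps)
qed

lemma sum_le_quantiles:
  fixes y :: "'a \<Rightarrow> real"
  assumes fin: "finite U" and M: "\<And>v. v \<in> U \<Longrightarrow> y v \<le> M"
    and mono: "\<And>i. i < j \<Longrightarrow> \<tau> (Suc i) \<le> \<tau> i" "\<tau> 0 \<le> M"
    and q: "\<And>i. i \<le> j \<Longrightarrow> real (card {v \<in> U. \<tau> i < y v}) \<le> (real i * \<kappa> + \<eta>) * real (card U)"
  shows "sum y U \<le> real (card U) * (M * \<eta> + \<kappa> * (\<Sum>i<j. \<tau> i) + (1 - (real j * \<kappa> + \<eta>)) * \<tau> j)"
proof -
  \<comment> \<open>The bound \<open>M\<close> is put in front as level zero: it is the value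
    charged to the heaviest \<open>\<eta>\<close> fraction.\<close>
  define t where "t i = (case i of 0 \<Rightarrow> M | Suc i \<Rightarrow> \<tau> i)" for i
  have t: "t 0 = M" "t (Suc i) = \<tau> i" for i by (simp_all add: t_def)
  have tm: "t (Suc i) \<le> t i" if "i < Suc j" for i
    using that mono by (cases i) (auto simp: t)
  have "sum y U \<le> (\<Sum>v\<in>U. t (Suc j) + (\<Sum>i<Suc j. (t i - t (Suc i)) * of_bool (t (Suc i) < y v)))"
    by (intro sum_mono le_layers tm) (use M t in auto)
  also have "\<dots> = real (card U) * t (Suc j) +
      (\<Sum>v\<in>U. \<Sum>i<Suc j. (t i - t (Suc i)) * of_bool (t (Suc i) < y v))"
    by (simp only: sum.distrib sum_constant)
  also have "(\<Sum>v\<in>U. \<Sum>i<Suc j. (t i - t (Suc i)) * of_bool (t (Suc i) < y v))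
    = (\<Sum>i<Suc j. (t i - t (Suc i)) * real (card {v \<in> U. t (Suc i) < y v}))"
    by (subst sum.swap) (use fin in \<open>simp add: sum_distrib_left[symmetric] sum.If_cases Int_def of_bool_def del: sum.lessThan_Suc\<close>)
  also have "\<dots> \<le> (\<Sum>i<Suc j. (t i - t (Suc i)) * ((real i * \<kappa> + \<eta>) * real (card U)))"
  proof (intro sum_mono mult_left_mono)
    fix i assume i: "i \<in> {..<Suc j}"
    show "real (card {v \<in> U. t (Suc i) < y v}) \<le> (real i * \<kappa> + \<eta>) * real (card U)"
      unfolding t using i q by simp
    show "0 \<le> t i - t (Suc i)" using tm i by simp
  qed
  also have "\<dots> = real (card U) * (\<Sum>i<Suc j. (t i - t (Suc i)) * (real i * \<kappa> + \<eta>))"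
    unfolding sum_distrib_left by (rule sum.cong) (simp_all add: mult_ac)
  finally have "sum y U \<le> real (card U) *
      (t (Suc j) + (\<Sum>i<Suc j. (t i - t (Suc i)) * (real i * \<kappa> + \<eta>)))"
    by (simp only: distrib_left add_left_mono)
  from this[unfolded abel_sum_layers] show ?thesis unfolding t .
qed

text \<open>Each chosen vertex costs every later set at most \<open>D\<close> elements, so the
  reserve \<open>real i * D\<close> still leaves \<open>b\<close> choices at position i.\<close>

lemma card_cliques_ge:
  assumes "finite U" "0 \<le> b"
    and "\<And>i. i < length Zs \<Longrightarrow> Zs ! i \<subseteq> U' \<and> real i * D + b \<le> real (card (Zs ! i))"
    and "U' \<subseteq> U" "\<And>x. x \<in> U' \<Longrightarrow> real (card (U - nbrs G {x})) \<le> D"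
  shows "b ^ length Zs \<le> real (card (cliques G Zs))"
  using assms(3)
proof (induction "length Zs" arbitrary: Zs)
  case 0
  then show ?case by simp
next
  case (Suc l Ws)
  then obtain Z Zs where Ws: "Ws = Z # Zs" by (cases Ws) auto
  have prems: "(Z # Zs) ! i \<subseteq> U' \<and> real i * D + b \<le> real (card ((Z # Zs) ! i))"
    if "i < length (Z # Zs)" for i
    using Suc.prems[of i] that unfolding Ws .
  have Z: "Z \<subseteq> U'" "b \<le> real (card Z)"
    using prems[of 0] by auto
  have Zs: "Zs ! i \<subseteq> U'" "real (Suc i) * D + b \<le> real (card (Zs ! i))" if "i < length Zs" for i
    using prems[of "Suc i"] that by auto
  have "set (Z # Zs) \<subseteq> Pow U"
    using prems assms(4) by (fastforce simp only: in_set_conv_nth)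
  then have fin: "finite Z" "finite (cliques G Zs)"
    using finite_cliques[OF assms(1), of Zs G] finite_subset[OF _ assms(1)] by auto
  have "b ^ length Zs \<le> real (card (cliques G (restrict_nbrs G {x} Zs)))" if x: "x \<in> Z" for x
  proof -
    have "b ^ length (restrict_nbrs G {x} Zs) \<le> real (card (cliques G (restrict_nbrs G {x} Zs)))"
    proof (rule Suc.hyps(1))
      show "l = length (restrict_nbrs G {x} Zs)" using Suc.hyps(2) Ws by simp
    next
      fix i assume "i < length (restrict_nbrs G {x} Zs)"
      then have i: "i < length Zs" by simp
      have finZi: "finite (Zs ! i)" using Zs(1)[OF i] assms(1,4) finite_subset by metis
      have "card (Zs ! i) \<le> card ((Zs ! i \<inter> nbrs G {x}) \<union> (U - nbrs G {x}))"
        by (rule card_mono) (use finZi assms(1,4) Zs(1)[OF i] in auto)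
      also have "\<dots> \<le> card (Zs ! i \<inter> nbrs G {x}) + card (U - nbrs G {x})"
        by (rule card_Un_le)
      finally have "real (card (Zs ! i)) \<le> real (card (Zs ! i \<inter> nbrs G {x})) + D"
        using assms(5)[of x] x Z(1) by fastforce
      then show "restrict_nbrs G {x} Zs ! i \<subseteq> U' \<and>
          real i * D + b \<le> real (card (restrict_nbrs G {x} Zs ! i))"
        using Zs[OF i] i by (auto simp: algebra_simps)
    qed
    then show ?thesis by simp
  qed
  then have "real (card Z) * b ^ length Zs \<le> real (card (cliques G (Z # Zs)))"
    unfolding card_cliques_Cons_heads[OF fin] of_nat_sum by (intro sum_bounded_below)
  moreover have "b * b ^ length Zs \<le> real (card Z) * b ^ length Zs"
    by (intro mult_right_mono Z) (use assms(2) in simp)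
  ultimately show ?case unfolding Ws by simp
qed

text \<open>Blobs are shrunk to the prescribed sizes. They are disjoint automatically: a common
  vertex would be a loop of G.\<close>

lemma joined_blobs_imp_clique:
  fixes y :: "nat \<Rightarrow> real"
  assumes blobs: "joined_blobs G F k Zs Qs" and k: "0 < k" and G: "graph_on n G"
    and m: "\<And>i. i < length Zs \<Longrightarrow> m i \<le> k"
    and \<tau>: "\<And>i v. i < length Zs \<Longrightarrow> v \<in> Zs ! i \<Longrightarrow> \<tau> i \<le> y v"
  shows "\<exists>e. e \<subseteq> \<Union> (set Zs) \<and> card e = (\<Sum>i<length Zs. m i) \<and> is_clique (G \<union> F) e \<and>
    (\<Sum>i<length Zs. real (m i) * \<tau> i) \<le> sum y e"
proof -
  let ?l = "length Zs"
  have Q: "Qs ! i \<subseteq> Zs ! i" "card (Qs ! i) = k" "is_clique F (Qs ! i)" if "i < ?l" for i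
    using blobs that by (auto simp: joined_blobs_def)
  have join: "{u, v} \<in> G" if "i < j" "j < ?l" "u \<in> Qs ! i" "v \<in> Qs ! j" for i j u v
  proof -
    have "Qs ! j \<subseteq> nbrs G (Qs ! i)" using blobs that(1,2) unfolding joined_blobs_def by blast
    then show ?thesis using that(3,4) by (auto simp: nbrs_def)
  qed
  have "\<exists>R. R \<subseteq> Qs ! i \<and> card R = m i" if "i < ?l" for i
    using obtain_subset_with_card_n[of "m i" "Qs ! i"] m[OF that] Q(2)[OF that] by metis
  then obtain R where R: "\<And>i. i < ?l \<Longrightarrow> R i \<subseteq> Qs ! i \<and> card (R i) = m i" by metis
  have finR: "finite (R i)" if "i < ?l" for i
    using R[OF that] Q(2)[OF that] k by (metis card.infinite finite_subset less_irrefl)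
  have loop: "{x, x} \<notin> G" for x
    using G unfolding graph_on_def all_pairs_eq_pairs by auto
  have join': "{u, v} \<in> G" if "i \<noteq> j" "i < ?l" "j < ?l" "u \<in> R i" "v \<in> R j" for i j u v
  proof (cases "i < j")
    case True
    then show ?thesis using join R that by blast
  next
    case False
    then have "{v, u} \<in> G" using join[of j i v u] R that by fastforce
    then show ?thesis by (simp add: insert_commute)
  qed
  have disj: "R i \<inter> R j = {}" if "i \<noteq> j" "i < ?l" "j < ?l" for i j
    using join'[OF that] loop by blast
  define e where "e = (\<Union>i<?l. R i)"
  have "e \<subseteq> \<Union> (set Zs)"
  proof
    fix v assume "v \<in> e"
    then obtain i where "i < ?l" "v \<in> R i" by (auto simp: e_def)
    then have "v \<in> Zs ! i" using R Q(1) by blast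
    then show "v \<in> \<Union> (set Zs)" using \<open>i < ?l\<close> nth_mem by blast
  qed
  moreover have "card e = (\<Sum>i<?l. m i)"
    unfolding e_def using finR disj R by (subst card_UN_disjoint) auto
  moreover have "is_clique (G \<union> F) e"
    unfolding is_clique_def
  proof (intro ballI impI)
    fix u v assume "u \<in> e" "v \<in> e" and neq: "u \<noteq> v"
    then obtain i j where ij: "i < ?l" "u \<in> R i" "j < ?l" "v \<in> R j" by (auto simp: e_def)
    show "{u, v} \<in> G \<union> F"
    proof (cases "i = j")
      case True
      then have "u \<in> Qs ! i" "v \<in> Qs ! i" using ij R by blast+
      then show ?thesis using Q(3)[OF ij(1)] neq by (simp add: is_clique_def)
    next
      case False
      then show ?thesis using join' ij by blast
    qed
  qed
  moreover have "(\<Sum>i<?l. real (m i) * \<tau> i) \<le> sum y e"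
  proof -
    have "(\<Sum>i<?l. real (m i) * \<tau> i) \<le> (\<Sum>i<?l. sum y (R i))"
    proof (rule sum_mono)
      fix i assume "i \<in> {..<?l}"
      then have i: "i < ?l" by simp
      have "real (card (R i)) * \<tau> i \<le> sum y (R i)"
        by (rule sum_bounded_below) (use \<tau>[OF i] R[OF i] Q(1)[OF i] in blast)
      then show "real (m i) * \<tau> i \<le> sum y (R i)" using R[OF i] by simp
    qed
    also have "\<dots> = sum y e"
      unfolding e_def by (rule sum.UNION_disjoint[symmetric]) (use finR disj in auto)
    finally show ?thesis .
  qed
  ultimately show ?thesis by blast
qed

section \<open>The greedy tiling\<close>

text \<open>Greedily picking the heaviest vertex of the common neighbourhood of \<open>i\<close> vertices, each missing
  at most a \<open>k / r\<close> fraction of \<open>U\<close>, gives weight at least the upper \<open>i * k / r\<close> quantile of \<open>y\<close>.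
  Taking each of these vertices with multiplicity \<open>k\<close> (the last with multiplicity \<open>s\<close>) bounds the
  integral of the quantile function by an upper step sum, so the total weight is at least \<open>r\<close> times the
  average of \<open>y\<close>. The slack \<open>\<eta>\<close> leaves room for linearly many choices at each step.\<close>

lemma exists_heavy_tile:
  fixes y :: "nat \<Rightarrow> real"
  assumes k: "0 < k" "k \<le> r" and j: "j = (r - 1) div k"
    and \<eta>: "0 < \<eta>" "\<eta> \<le> 1 / real r"
    and G: "graph_on n G"
    and U: "U \<subseteq> {0..<n}" "\<alpha> * real n \<le> real (card U)" "U \<noteq> {}" "0 < \<alpha>"
    and X: "real (card X) \<le> \<eta> / 2 * real (card U)" "finite X"
    and deg: "\<And>x. x \<in> U - X \<Longrightarrow> real (card (U - nbrs G {x})) \<le> real k / real r * real (card U)"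
    and y: "\<And>v. v \<in> U \<Longrightarrow> \<bar>y v\<bar> \<le> M" "0 \<le> sum y U"
    and blobs: "\<And>Zs. length Zs = Suc j \<Longrightarrow> set Zs \<subseteq> Pow {0..<n} \<Longrightarrow>
      (\<eta> / 2 * \<alpha>) ^ Suc j * real n ^ Suc j \<le> real (card (cliques G Zs)) \<Longrightarrow>
      \<exists>Qs. joined_blobs G F k Zs Qs"
  shows "\<exists>e\<subseteq>U. card e = r \<and> is_clique (G \<union> F) e \<and> - (2 * real r * \<eta> * M) \<le> sum y e"
proof -
  define u where "u = real (card U)"
  define \<kappa> where "\<kappa> = real k / real r"
  \<comment> \<open>With \<open>(r - 1) div k\<close> instead of \<open>r div k\<close>, the last
    part has between 1 and k vertices even when k divides r.\<close>
  define s where "s = r - j * k"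
  define m where "m i = (if i = j then s else k)" for i
  have finU: "finite U" using U(1) finite_subset by blast
  have u0: "0 < u" using finU U(3) by (simp add: u_def card_gt_0_iff)
  have r0: "0 < r" using k by simp
  have jk: "j * k \<le> r - 1" unfolding j by (rule div_times_less_eq_dividend)
  have "r - 1 < k + k * j" unfolding j by (rule dividend_less_times_div) (rule k)
  then have s: "1 \<le> s" "s \<le> k" "r = j * k + s" using jk r0 by (simp_all add: s_def mult.commute)
  have \<kappa>0: "0 \<le> \<kappa>" by (simp add: \<kappa>_def)
  have j\<kappa>: "real j * \<kappa> = 1 - real s / real r"
  proof -
    have "real r = real j * real k + real s" using s(3) by (metis of_nat_add of_nat_mult)
    then show ?thesis using r0 by (simp add: \<kappa>_def field_simps)
  qed
  \<comment> \<open>The largest quantile level must not exceed 1; this is what the bound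
    \<open>\<eta> \<le> 1 / real r\<close> is for.\<close>
  have "1 / real r \<le> real s / real r" using s(1) by (intro divide_right_mono) auto
  then have aj: "real j * \<kappa> + \<eta> \<le> 1" using j\<kappa> \<eta>(2) by linarith
  have a: "0 < real i * \<kappa> + \<eta>" "real i * \<kappa> + \<eta> \<le> 1" if "i \<le> j" for i
  proof -
    show "0 < real i * \<kappa> + \<eta>" using \<kappa>0 \<eta>(1) by (simp add: add_nonneg_pos)
    have "real i * \<kappa> \<le> real j * \<kappa>" using that \<kappa>0 by (intro mult_right_mono) auto
    then show "real i * \<kappa> + \<eta> \<le> 1" using aj by linarith
  qed
  have "\<forall>i. \<exists>\<sigma>. i \<le> j \<longrightarrow> (real i * \<kappa> + \<eta>) * u \<le> real (card {v \<in> U. \<sigma> \<le> y v}) \<and>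
    real (card {v \<in> U. \<sigma> < y v}) < (real i * \<kappa> + \<eta>) * u"
    using quantile_exists[OF finU U(3) a] unfolding u_def by blast
  from choice[OF this] obtain \<tau> where \<tau>1: "\<And>i. i \<le> j \<Longrightarrow> (real i * \<kappa> + \<eta>) * u \<le> real (card {v \<in> U. \<tau> i \<le> y v})"
    and \<tau>2: "\<And>i. i \<le> j \<Longrightarrow> real (card {v \<in> U. \<tau> i < y v}) < (real i * \<kappa> + \<eta>) * u"
    by blast
  \<comment> \<open>Half of the slack \<open>\<eta>\<close> pays for deleting \<open>X\<close>; the
    other half remains as the number of choices per step.\<close>
  define Zs where "Zs = map (\<lambda>i. {v \<in> U - X. \<tau> i \<le> y v}) [0..<Suc j]"
  have lenZ: "length Zs = Suc j" by (simp add: Zs_def)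
  have nthZ: "Zs ! i = {v \<in> U - X. \<tau> i \<le> y v}" if "i < Suc j" for i
    unfolding Zs_def using that by (simp del: upt_Suc)
  have setZ: "\<Union> (set Zs) \<subseteq> U" by (auto simp: Zs_def)
  have "(\<eta> / 2 * u) ^ length Zs \<le> real (card (cliques G Zs))"
  proof (rule card_cliques_ge[OF finU])
    show "0 \<le> \<eta> / 2 * u" using \<eta> u0 by simp
    show "U - X \<subseteq> U" by auto
    show "real (card (U - nbrs G {x})) \<le> \<kappa> * u" if "x \<in> U - X" for x
      using deg[OF that] by (simp add: \<kappa>_def u_def)
    fix i assume "i < length Zs"
    then have i: "i < Suc j" by (simp add: lenZ)
    have "card {v \<in> U. \<tau> i \<le> y v} \<le> card ({v \<in> U - X. \<tau> i \<le> y v} \<union> X)"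
      by (rule card_mono) (use finU X(2) in auto)
    also have "\<dots> \<le> card {v \<in> U - X. \<tau> i \<le> y v} + card X" by (rule card_Un_le)
    finally have "(real i * \<kappa> + \<eta>) * u \<le> real (card (Zs ! i)) + \<eta> / 2 * u"
      using \<tau>1[of i] i X(1) unfolding nthZ[OF i] u_def by linarith
    then show "Zs ! i \<subseteq> U - X \<and> real i * (\<kappa> * u) + \<eta> / 2 * u \<le> real (card (Zs ! i))"
      using nthZ[OF i] by (auto simp: algebra_simps)
  qed
  moreover have "(\<eta> / 2 * \<alpha>) ^ Suc j * real n ^ Suc j \<le> (\<eta> / 2 * u) ^ Suc j"
    unfolding power_mult_distrib[symmetric]
  proof (rule power_mono)
    show "\<eta> / 2 * \<alpha> * real n \<le> \<eta> / 2 * u"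
      using mult_left_mono[OF U(2), of "\<eta> / 2"] \<eta> by (simp add: u_def mult.assoc)
    show "0 \<le> \<eta> / 2 * \<alpha> * real n" using \<eta> U(4) by simp
  qed
  ultimately have "(\<eta> / 2 * \<alpha>) ^ Suc j * real n ^ Suc j \<le> real (card (cliques G Zs))"
    unfolding lenZ by linarith
  moreover have "set Zs \<subseteq> Pow {0..<n}" using setZ U(1) by blast
  ultimately obtain Qs where Qs: "joined_blobs G F k Zs Qs" using blobs[OF lenZ] by blast
  obtain e where e: "e \<subseteq> \<Union> (set Zs)" "card e = (\<Sum>i<length Zs. m i)" "is_clique (G \<union> F) e"
    "(\<Sum>i<length Zs. real (m i) * \<tau> i) \<le> sum y e"
    using joined_blobs_imp_clique[OF Qs k(1) G, of m \<tau> y] s(2) nthZ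
    by (fastforce simp: m_def lenZ)
  have "(\<Sum>i<length Zs. m i) = r"
    unfolding lenZ using s(3) by (simp add: m_def)
  then have card_e: "card e = r" using e(2) by simp
  have "(\<Sum>i<length Zs. real (m i) * \<tau> i) = real k * (\<Sum>i<j. \<tau> i) + real s * \<tau> j"
    unfolding lenZ by (simp add: m_def sum_distrib_left)
  then have low: "real k * (\<Sum>i<j. \<tau> i) + real s * \<tau> j \<le> sum y e" using e(4) by simp
  have \<tau>mono: "\<tau> (Suc i) \<le> \<tau> i" if "i < j" for i
  proof (rule quantile_antimono[OF finU])
    show "real i * \<kappa> + \<eta> \<le> real (Suc i) * \<kappa> + \<eta>" using \<kappa>0 by (simp add: algebra_simps)
  qed (use \<tau>1[of "Suc i"] \<tau>2[of i] that in \<open>auto simp: u_def\<close>)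
  have "0 < (real 0 * \<kappa> + \<eta>) * u" using \<eta> u0 by simp
  then have "0 < card {v \<in> U. \<tau> 0 \<le> y v}" using \<tau>1[of 0] by linarith
  then obtain v where "v \<in> U" "\<tau> 0 \<le> y v" by (auto simp: card_gt_0_iff)
  then have \<tau>0: "\<tau> 0 \<le> M" using y(1)[of v] by linarith
  have "\<exists>v\<in>U. y v \<le> \<tau> j"
  proof (rule ccontr)
    assume "\<not> (\<exists>v\<in>U. y v \<le> \<tau> j)"
    then have "{v \<in> U. \<tau> j < y v} = U" by auto
    then have "u < (real j * \<kappa> + \<eta>) * u" using \<tau>2[of j] by (simp add: u_def)
    moreover have "(real j * \<kappa> + \<eta>) * u \<le> 1 * u" using aj u0 by (intro mult_right_mono) auto
    ultimately show False by simp
  qed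
  then have \<tau>j: "- M \<le> \<tau> j" using y(1) by fastforce
  have "sum y U \<le> real (card U) * (M * \<eta> + \<kappa> * (\<Sum>i<j. \<tau> i) + (1 - (real j * \<kappa> + \<eta>)) * \<tau> j)"
    by (rule sum_le_quantiles[OF finU])
      (use y(1) \<tau>mono \<tau>0 \<tau>2 in \<open>fastforce simp: u_def less_imp_le\<close>)+
  then have "0 \<le> u * (M * \<eta> + \<kappa> * (\<Sum>i<j. \<tau> i) + (1 - (real j * \<kappa> + \<eta>)) * \<tau> j)"
    using y(2) by (simp add: u_def)
  then have "0 \<le> M * \<eta> + \<kappa> * (\<Sum>i<j. \<tau> i) + (1 - (real j * \<kappa> + \<eta>)) * \<tau> j"
    using u0 by (simp add: zero_le_mult_iff)
  also have "\<dots> = M * \<eta> + (real k * (\<Sum>i<j. \<tau> i) + real s * \<tau> j) / real r - \<eta> * \<tau> j"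
  proof -
    have *: "1 - (real j * \<kappa> + \<eta>) = real s / real r - \<eta>" using j\<kappa> by simp
    show ?thesis unfolding * by (simp add: \<kappa>_def left_diff_distrib add_divide_distrib)
  qed
  \<comment> \<open>Two losses of \<open>\<eta> * M\<close>: the top \<open>\<eta>\<close> fraction
    was charged at \<open>M\<close>, and the shift of the levels takes weight \<open>\<eta>\<close>
    from \<open>\<tau> j\<close>, of which only \<open>- M \<le> \<tau> j\<close> is known.\<close>
  also have "\<dots> \<le> M * \<eta> + sum y e / real r + \<eta> * M"
  proof -
    have "(real k * (\<Sum>i<j. \<tau> i) + real s * \<tau> j) / real r \<le> sum y e / real r"
      using low by (rule divide_right_mono) simp
    moreover have "\<eta> * (- M) \<le> \<eta> * \<tau> j" using \<tau>j \<eta> by (intro mult_left_mono) auto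
    ultimately show ?thesis by (simp add: mult.commute[of M])
  qed
  finally have "- (2 * \<eta> * M) \<le> sum y e / real r" by (simp add: algebra_simps)
  then have "- (2 * real r * \<eta> * M) \<le> sum y e"
    using r0 by (simp add: field_simps)
  then show ?thesis using e(1,3) card_e setZ by blast
qed

section \<open>Degree deviations as a potential\<close>

lemma sum_abs_le_of_sum_squares:
  fixes f :: "'a \<Rightarrow> real"
  assumes "(\<Sum>i\<in>I. (f i)\<^sup>2) \<le> real (card I) * w\<^sup>2" "0 < w"
  shows "(\<Sum>i\<in>I. \<bar>f i\<bar>) \<le> real (card I) * w"
proof -
  have "(\<Sum>i\<in>I. \<bar>f i\<bar>) \<le> (\<Sum>i\<in>I. ((f i)\<^sup>2 / w + w) / 2)"
  proof (rule sum_mono)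
    fix i
    have "0 \<le> (\<bar>f i\<bar> - w)\<^sup>2" by simp
    then have "2 * w * \<bar>f i\<bar> \<le> (f i)\<^sup>2 + w\<^sup>2" by (simp add: power2_diff mult_ac)
    then show "\<bar>f i\<bar> \<le> ((f i)\<^sup>2 / w + w) / 2"
      using assms(2) by (simp add: field_simps power2_eq_square)
  qed
  also have "\<dots> = ((\<Sum>i\<in>I. (f i)\<^sup>2) / w + real (card I) * w) / 2"
    by (simp add: sum.distrib sum_divide_distrib[symmetric])
  also have "(\<Sum>i\<in>I. (f i)\<^sup>2) / w \<le> real (card I) * w"
    using assms by (simp add: divide_le_eq power2_eq_square mult.assoc)
  finally show ?thesis by (simp add: mult.commute)
qed

lemma degree_le: "degree n G v \<le> n"
proof -
  have "{u. u < n \<and> {u, v} \<in> G} \<subseteq> {0..<n}" by auto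
  from card_mono[OF _ this] show ?thesis by (simp add: degree_def)
qed

lemma card_Union_tiling:
  assumes "Kr_tiling n r E T" "finite T"
  shows "card (\<Union> T) = r * card T"
proof -
  have "finite S" if "S \<in> T" for S
  proof (rule finite_subset)
    show "S \<subseteq> {0..<n}" using assms(1) that by (simp add: Kr_tiling_def)
  qed simp
  then have "card (\<Union> T) = sum card T"
    using assms(1) by (intro card_Union_disjoint) (auto simp: Kr_tiling_def pairwise_def disjnt_def)
  also have "\<dots> = card T * r"
    using assms(1) by (simp add: Kr_tiling_def)
  finally show ?thesis by simp
qed

lemma Kr_tiling_mono:
  assumes "Kr_tiling n r E T" "E \<subseteq> E'"
  shows "Kr_tiling n r E' T"
proof -
  have "is_clique E' S" if "is_clique E S" for S
    using that assms(2) by (auto simp: is_clique_def)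
  then show ?thesis using assms(1) by (simp add: Kr_tiling_def)
qed

text \<open>Deterministic from here on: F is constrained only by \<open>blobs\<close>. The factor 50
  makes 25 \<eta>^2 n^3 / (\<gamma> \<alpha> n)^2, a bound on the number of exceptional vertices, at
  most \<eta> \<alpha> n / 2. The lower bound on n absorbs the second-order term r^2 n of a
  step.\<close>

locale greedy_tiling =
  fixes n k r :: nat and G F :: "nat set set" and \<alpha> \<gamma> \<eta> :: real and j :: nat
  assumes k: "0 < k" "k \<le> r" and j: "j = (r - 1) div k"
    and pos: "0 < \<alpha>" "0 < \<gamma>" "0 < \<eta>" "0 < n"
    and \<eta>: "\<eta> \<le> 1 / real r" "\<eta> \<le> \<gamma>\<^sup>2 * \<alpha> ^ 3 / 50"
    and n: "real r \<le> \<eta>\<^sup>2 * real n"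
    and G: "graph_on n G" "min_degree_ge n G ((1 - real k / real r + \<gamma>) * real n)"
    and blobs: "\<And>Zs. length Zs = Suc j \<Longrightarrow> set Zs \<subseteq> Pow {0..<n} \<Longrightarrow>
      (\<eta> / 2 * \<alpha>) ^ Suc j * real n ^ Suc j \<le> real (card (cliques G Zs)) \<Longrightarrow>
      \<exists>Qs. joined_blobs G F k Zs Qs"
begin

definition deviation :: "nat \<Rightarrow> nat \<Rightarrow> real" where
  "deviation v u = of_bool ({u, v} \<in> G) - real (degree n G v) / real n"

definition potential :: "nat set \<Rightarrow> real" where
  "potential U = (\<Sum>v<n. (sum (deviation v) U)\<^sup>2)"

lemma sum_deviation:
  assumes "U \<subseteq> {0..<n}"
  shows "sum (deviation v) U =
    real (card (U \<inter> nbrs G {v})) - real (degree n G v) / real n * real (card U)"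
proof -
  have "finite U" using assms finite_subset by blast
  moreover have "U \<inter> nbrs G {v} = {u \<in> U. {u, v} \<in> G}"
    by (auto simp: nbrs_def insert_commute)
  ultimately show ?thesis
    by (simp add: deviation_def sum_subtractf Int_def)
qed

lemma potential_all: "potential {0..<n} = 0"
proof -
  have "card ({0..<n} \<inter> nbrs G {v}) = degree n G v" for v
    unfolding degree_def by (rule arg_cong[of _ _ card]) (auto simp: nbrs_def insert_commute)
  then show ?thesis unfolding potential_def using pos by (simp add: sum_deviation)
qed

lemma abs_deviation_le: "\<bar>deviation v u\<bar> \<le> 1"
proof -
  have "real (degree n G v) / real n \<le> 1" using degree_le pos by simp
  moreover have "0 \<le> real (degree n G v) / real n" by simp
  ultimately show ?thesis unfolding deviation_def by (cases "{u, v} \<in> G") auto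
qed

text \<open>The potential is quadratic, so removing \<open>e\<close> changes it by
  \<open>- 2 * sum y e\<close> and a second-order term. If it is at most c^2 \<eta>^2 n^3, the
  weights are at most c \<eta> n^2, and a step costs (4c + 1) r \<eta>^2 n^2. Over n/r steps this is
  consistent if 4c + 1 \<le> c^2; c = 5 gives 21 and 25.\<close>

lemma next_tile:
  assumes U: "U \<subseteq> {0..<n}" "\<alpha> * real n < real (card U)"
    and pot: "potential U \<le> 25 * \<eta>\<^sup>2 * real n ^ 3"
  shows "\<exists>e\<subseteq>U. card e = r \<and> is_clique (G \<union> F) e \<and>
    potential (U - e) \<le> potential U + 21 * real r * \<eta>\<^sup>2 * real n ^ 2"
proof -
  define D where "D v = sum (deviation v) U" for v
  define y where "y u = (\<Sum>v<n. D v * deviation v u)" for u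
  define M where "M = 5 * \<eta> * real n ^ 2"
  define X where "X = {x \<in> U. real k / real r * real (card U) < real (card (U - nbrs G {x}))}"
  have finU: "finite U" using U(1) finite_subset by blast
  have potD: "potential U = (\<Sum>v<n. (D v)\<^sup>2)" by (simp add: potential_def D_def)
  have sumy: "sum y U = potential U"
    unfolding y_def potD by (subst sum.swap) (simp add: D_def power2_eq_square flip: sum_distrib_left)
  \<comment> \<open>The bound on the potential also controls the weights. This makes the potential, and hence the
    number of exceptional vertices, quadratic in \<open>\<eta>\<close>, while the quantiles tolerate a linear number.\<close>
  have sumD: "(\<Sum>v<n. \<bar>D v\<bar>) \<le> M"
  proof -
    have "(\<Sum>v<n. \<bar>D v\<bar>) \<le> real (card {..<n}) * (5 * \<eta> * real n)"
    proof (rule sum_abs_le_of_sum_squares)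
      show "(\<Sum>v<n. (D v)\<^sup>2) \<le> real (card {..<n}) * (5 * \<eta> * real n)\<^sup>2"
        using pot unfolding potD by (simp add: power_mult_distrib power3_eq_cube power2_eq_square mult_ac)
    qed (use pos in simp)
    then show ?thesis by (simp add: M_def power2_eq_square mult_ac)
  qed
  have y_le: "\<bar>y u\<bar> \<le> M" for u
  proof -
    have "\<bar>y u\<bar> \<le> (\<Sum>v<n. \<bar>D v * deviation v u\<bar>)" unfolding y_def by (rule sum_abs)
    also have "\<dots> \<le> (\<Sum>v<n. \<bar>D v\<bar>)"
      unfolding abs_mult by (intro sum_mono mult_left_le abs_deviation_le) auto
    finally show ?thesis using sumD by linarith
  qed
  \<comment> \<open>An exceptional vertex has at least \<open>\<gamma> * card U\<close> fewer
    neighbours in \<open>U\<close> than its proportional share, so it contributes at least (\<gamma>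
    \<alpha> n)^2 to the potential.\<close>
  have Xle: "real (card X) \<le> \<eta> / 2 * real (card U)"
  proof -
    have X0: "(\<gamma> * \<alpha> * real n)\<^sup>2 \<le> (D x)\<^sup>2" if "x \<in> X" for x
    proof -
      have x: "x \<in> U" "real k / real r * real (card U) < real (card (U - nbrs G {x}))"
        using that by (auto simp: X_def)
      have "card U = card (U \<inter> nbrs G {x}) + card (U - nbrs G {x})"
        using finU by (metis card_Int_Diff)
      then have "real (card (U \<inter> nbrs G {x})) \<le> (1 - real k / real r) * real (card U)"
        using x(2) by (simp add: algebra_simps)
      moreover have "1 - real k / real r + \<gamma> \<le> real (degree n G x) / real n"
        using G(2) x(1) U(1) pos by (auto simp: min_degree_ge_def le_divide_eq)
      then have "(1 - real k / real r + \<gamma>) * real (card U) \<le>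
          real (degree n G x) / real n * real (card U)"
        by (rule mult_right_mono) simp
      ultimately have "D x \<le> - (\<gamma> * real (card U))"
        unfolding D_def sum_deviation[OF U(1)] by (simp add: algebra_simps)
      moreover have "\<gamma> * (\<alpha> * real n) \<le> \<gamma> * real (card U)"
        using U(2) pos by (intro mult_left_mono) auto
      ultimately have "\<gamma> * \<alpha> * real n \<le> - D x" by (simp add: mult.assoc)
      then have "(\<gamma> * \<alpha> * real n)\<^sup>2 \<le> (- D x)\<^sup>2" by (rule power_mono) (use pos in simp)
      then show ?thesis by simp
    qed
    have XU: "X \<subseteq> {..<n}" using U(1) by (auto simp: X_def)
    have "real (card X) * (\<gamma> * \<alpha> * real n)\<^sup>2 \<le> (\<Sum>x\<in>X. (D x)\<^sup>2)"
      by (rule sum_bounded_below) (rule X0)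
    also have "\<dots> \<le> (\<Sum>x<n. (D x)\<^sup>2)" by (rule sum_mono2) (use XU in auto)
    also have "\<dots> \<le> 25 * \<eta>\<^sup>2 * real n ^ 3" using pot by (simp add: potD)
    also have "\<dots> = 25 * \<eta> * (\<eta> * real n ^ 3)" by (simp add: power2_eq_square)
    also have "\<dots> \<le> 25 * (\<gamma>\<^sup>2 * \<alpha> ^ 3 / 50) * (\<eta> * real n ^ 3)"
      by (intro mult_right_mono mult_left_mono \<eta>(2)) (use pos in auto)
    also have "\<dots> = \<eta> / 2 * (\<alpha> * real n) * (\<gamma> * \<alpha> * real n)\<^sup>2"
      by (simp add: power2_eq_square power3_eq_cube)
    finally have "real (card X) \<le> \<eta> / 2 * (\<alpha> * real n)"
      using pos by (simp add: mult_le_cancel_right)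
    also have "\<dots> \<le> \<eta> / 2 * real (card U)" using U(2) pos by (intro mult_left_mono) auto
    finally show ?thesis .
  qed
  have "\<exists>e\<subseteq>U. card e = r \<and> is_clique (G \<union> F) e \<and> - (2 * real r * \<eta> * M) \<le> sum y e"
  proof (rule exists_heavy_tile[OF k j pos(3) \<eta>(1) G(1) U(1) _ _ pos(1) Xle _ _ y_le _ blobs])
    show "\<alpha> * real n \<le> real (card U)" using U(2) by simp
    have "0 < \<alpha> * real n" using pos by simp
    then show "U \<noteq> {}" using U(2) by auto
    show "finite X" using finU by (simp add: X_def)
    show "0 \<le> sum y U" unfolding sumy potential_def by (simp add: sum_nonneg)
  qed (auto simp: X_def)
  then obtain e where e: "e \<subseteq> U" "card e = r" "is_clique (G \<union> F) e"
    "- (2 * real r * \<eta> * M) \<le> sum y e" by blast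
  have "potential (U - e) = (\<Sum>v<n. (D v - sum (deviation v) e)\<^sup>2)"
    unfolding potential_def D_def using finU e(1) by (simp add: sum_diff)
  also have "\<dots> = potential U - 2 * (\<Sum>v<n. D v * sum (deviation v) e) + (\<Sum>v<n. (sum (deviation v) e)\<^sup>2)"
    by (simp add: potD power2_diff sum.distrib sum_subtractf sum_distrib_left mult_ac)
  also have "(\<Sum>v<n. D v * sum (deviation v) e) = sum y e"
    unfolding y_def sum_distrib_left by (rule sum.swap)
  also have "(\<Sum>v<n. (sum (deviation v) e)\<^sup>2) \<le> real (card {..<n}) * (real r)\<^sup>2"
  proof (rule sum_bounded_above)
    fix v
    have "\<bar>sum (deviation v) e\<bar> \<le> (\<Sum>u\<in>e. \<bar>deviation v u\<bar>)" by (rule sum_abs)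
    also have "\<dots> \<le> real (card e) * 1" by (rule sum_bounded_above) (rule abs_deviation_le)
    finally have "\<bar>sum (deviation v) e\<bar>\<^sup>2 \<le> (real r)\<^sup>2" using e(2) by (intro power_mono) auto
    then show "(sum (deviation v) e)\<^sup>2 \<le> (real r)\<^sup>2" by simp
  qed
  finally have "potential (U - e) \<le> potential U - 2 * sum y e + real n * (real r)\<^sup>2" by simp
  also have "\<dots> \<le> potential U + 20 * real r * \<eta>\<^sup>2 * real n ^ 2 + real r * \<eta>\<^sup>2 * real n ^ 2"
  proof -
    have "real n * real r * real r \<le> real n * real r * (\<eta>\<^sup>2 * real n)"
      by (intro mult_left_mono n) simp
    then have "real n * (real r)\<^sup>2 \<le> real r * \<eta>\<^sup>2 * real n ^ 2"
      by (simp add: power2_eq_square mult_ac)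
    moreover have "- (2 * sum y e) \<le> 20 * real r * \<eta>\<^sup>2 * real n ^ 2"
      using e(4) by (simp add: M_def power2_eq_square mult_ac)
    ultimately show ?thesis by linarith
  qed
  finally have "potential (U - e) \<le> potential U + 21 * real r * \<eta>\<^sup>2 * real n ^ 2" by simp
  then show ?thesis using e(1-3) by blast
qed

text \<open>The first alternative freezes a tiling that already covers enough, so that the induction
  runs through all t.\<close>

lemma tiling_after_steps:
  "\<exists>T. Kr_tiling n r (G \<union> F) T \<and> finite T \<and> (real n - \<alpha> * real n \<le> real (card (\<Union> T)) \<or>
    card T = t \<and> potential ({0..<n} - \<Union> T) \<le> real t * (21 * real r * \<eta>\<^sup>2 * real n ^ 2))"
proof (induction t)
  case 0
  show ?case by (rule exI[of _ "{}"]) (simp add: Kr_tiling_def potential_all)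
next
  case (Suc t)
  then obtain T where T: "Kr_tiling n r (G \<union> F) T" "finite T"
    and alt: "real n - \<alpha> * real n \<le> real (card (\<Union> T)) \<or>
      card T = t \<and> potential ({0..<n} - \<Union> T) \<le> real t * (21 * real r * \<eta>\<^sup>2 * real n ^ 2)"
    by blast
  show ?case
  proof (cases "real n - \<alpha> * real n \<le> real (card (\<Union> T))")
    case True
    then show ?thesis using T by blast
  next
    case False
    let ?U = "{0..<n} - \<Union> T"
    have t: "card T = t" "potential ?U \<le> real t * (21 * real r * \<eta>\<^sup>2 * real n ^ 2)"
      using alt False by auto
    have sub: "\<Union> T \<subseteq> {0..<n}" using T(1) by (auto simp: Kr_tiling_def)
    have "card (\<Union> T) \<le> n" using card_mono[OF _ sub] by simp
    \<comment> \<open>Disjointness limits the number of tiles to n/r, which keeps the accumulated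
      potential below the bound required by \<open>next_tile\<close>.\<close>
    then have "real r * real t \<le> real n"
      unfolding card_Union_tiling[OF T] t(1) by (metis of_nat_le_iff of_nat_mult)
    then have "(real r * real t) * (21 * \<eta>\<^sup>2 * real n ^ 2) \<le> real n * (21 * \<eta>\<^sup>2 * real n ^ 2)"
      by (rule mult_right_mono) simp
    moreover have "21 * \<eta>\<^sup>2 * real n ^ 3 \<le> 25 * \<eta>\<^sup>2 * real n ^ 3"
      by (intro mult_right_mono) auto
    ultimately have "potential ?U \<le> 25 * \<eta>\<^sup>2 * real n ^ 3"
      using t(2) by (simp add: power2_eq_square power3_eq_cube mult_ac)
    moreover have "\<alpha> * real n < real (card ?U)"
    proof -
      have "card ?U = n - card (\<Union> T)" using card_Diff_subset[OF finite_subset[OF sub] sub] by simp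
      then show ?thesis using False \<open>card (\<Union> T) \<le> n\<close> by (simp add: of_nat_diff)
    qed
    ultimately obtain e where e: "e \<subseteq> ?U" "card e = r" "is_clique (G \<union> F) e"
      "potential (?U - e) \<le> potential ?U + 21 * real r * \<eta>\<^sup>2 * real n ^ 2"
      using next_tile[of ?U] by blast
    have eT: "e \<notin> T"
    proof
      assume "e \<in> T"
      then have "e = {}" using e(1) by blast
      then show False using e(2) k by simp
    qed
    have "Kr_tiling n r (G \<union> F) (insert e T)"
      unfolding Kr_tiling_def
    proof (intro conjI ballI impI)
      fix S assume "S \<in> insert e T"
      then show "S \<subseteq> {0..<n}" "card S = r" "is_clique (G \<union> F) S"
        using T(1) e(1-3) by (auto simp: Kr_tiling_def)
    next
      fix S S' assume S: "S \<in> insert e T" "S' \<in> insert e T" "S \<noteq> S'"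
      have dis: "e \<inter> W = {}" if "W \<in> T" for W using that e(1) by blast
      show "S \<inter> S' = {}"
      proof (cases "S \<in> T \<and> S' \<in> T")
        case True
        then show ?thesis using T(1) S(3) by (simp add: Kr_tiling_def)
      next
        case False
        then show ?thesis using S dis by blast
      qed
    qed
    moreover have "card (insert e T) = Suc t" using T(2) eT t(1) by simp
    moreover have "potential ({0..<n} - \<Union> (insert e T)) \<le>
        real (Suc t) * (21 * real r * \<eta>\<^sup>2 * real n ^ 2)"
    proof -
      have "{0..<n} - \<Union> (insert e T) = ?U - e" by auto
      then show ?thesis using e(4) t(2) by (simp add: algebra_simps)
    qed
    ultimately show ?thesis using T(2) by blast
  qed
qed

text \<open>After n + 1 steps only the covering alternative is left: n + 1 disjoint nonempty tiles
  do not fit.\<close>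

lemma almost_perfect_tiling:
  "\<exists>T. Kr_tiling n r (G \<union> F) T \<and> real n - \<alpha> * real n \<le> real (card (\<Union> T))"
proof -
  obtain T where T: "Kr_tiling n r (G \<union> F) T" "finite T"
    and alt: "real n - \<alpha> * real n \<le> real (card (\<Union> T)) \<or> card T = Suc n"
    using tiling_after_steps[of "Suc n"] by blast
  have "card (\<Union> T) \<le> n"
    using card_mono[of "{0..<n}" "\<Union> T"] T(1) by (auto simp: Kr_tiling_def)
  moreover have "card T \<le> r * card T" using k by simp
  ultimately have "card T \<noteq> Suc n" unfolding card_Union_tiling[OF T] by linarith
  then show ?thesis using T alt by blast
qed

end

section \<open>From the random graph to the deterministic tiling\<close>

theorem theorem5p1:
  fixes k r :: nat and \<alpha> \<gamma> :: real
  assumes "2 \<le> k" and "k \<le> r" and "\<alpha> > 0" and "\<gamma> > 0"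
  shows "\<exists>C>0. \<forall>(p :: nat \<Rightarrow> real) (G :: nat \<Rightarrow> nat set set).
           (\<forall>n. 0 \<le> p n \<and> p n \<le> 1) \<longrightarrow>
           (\<forall>\<^sub>F n in sequentially. p n \<ge> C * real n powr (- 2 / real k)) \<longrightarrow>
           (\<forall>n. graph_on n (G n)) \<longrightarrow>
           (\<forall>\<^sub>F n in sequentially.
              min_degree_ge n (G n) ((1 - real k / real r + \<gamma>) * real n)) \<longrightarrow>
           ((\<lambda>n. random_graph_prob n (p n)
                   (\<lambda>F. \<exists>T. Kr_tiling n r (G n \<union> F) T \<and>
                            real (card (\<Union>T)) \<ge> real n - \<alpha> * real n))
             \<longlonglongrightarrow> 1)"
proof -
  define j where "j = (r - 1) div k"
  define \<eta> where "\<eta> = min (1 / real r) (\<gamma>\<^sup>2 * \<alpha> ^ 3 / 50)"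
  have \<eta>: "0 < \<eta>" using assms by (simp add: \<eta>_def)
  have k0: "0 < k" using assms by simp
  have c0: "0 < (\<eta> / 2 * \<alpha>) ^ Suc j" using \<eta> assms by simp
  obtain \<beta> N where \<beta>: "0 < \<beta>" and blobs: "\<And>n G F Zs. N \<le> n \<Longrightarrow>
      length Zs = Suc j \<Longrightarrow> set Zs \<subseteq> Pow {0..<n} \<Longrightarrow>
      (\<eta> / 2 * \<alpha>) ^ Suc j * real n ^ Suc j \<le> real (card (cliques G Zs)) \<Longrightarrow>
      hits_extensible G k (Suc j) \<beta> n F \<Longrightarrow> \<exists>Qs. joined_blobs G F k Zs Qs"
    using dense_cliques_imp_joined_blobs[OF k0 c0, of "Suc j" "Suc j"] by blast
  obtain N' :: nat where N': "real r / \<eta>\<^sup>2 \<le> real N'" using real_arch_simple by blast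
  define K where "K = real (3 * Suc j + 2)"
  \<comment> \<open>Both \<open>\<beta>\<close> and \<open>K\<close> are fixed before p and G, so C
    depends only on the parameters. The maximum with 1 is needed to compare C with its
    powers.\<close>
  define C where "C = max 1 (2 * (K + 1) / \<beta>)"
  have C: "1 \<le> C" "2 * (K + 1) / \<beta> \<le> C" by (simp_all add: C_def)
  show ?thesis
  proof (intro exI[of _ C] conjI allI impI)
    show "0 < C" using C(1) by linarith
  next
    fix p :: "nat \<Rightarrow> real" and G :: "nat \<Rightarrow> nat set set"
    assume p: "\<forall>n. 0 \<le> p n \<and> p n \<le> 1"
      and pC: "\<forall>\<^sub>F n in sequentially. p n \<ge> C * real n powr (- 2 / real k)"
      and G: "\<forall>n. graph_on n (G n)"
      and deg: "\<forall>\<^sub>F n in sequentially. min_degree_ge n (G n) ((1 - real k / real r + \<gamma>) * real n)"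
    let ?p = "\<lambda>n. C * real n powr (- 2 / real k)"
    let ?A = "\<lambda>n F. \<exists>T. Kr_tiling n r (G n \<union> F) T \<and> real (card (\<Union>T)) \<ge> real n - \<alpha> * real n"
    let ?fail = "\<lambda>n F. \<exists>\<S>\<in>extensible_family (G n) k (Suc j) n.
      \<beta> * real n ^ k \<le> real (card \<S>) \<and> (\<forall>S\<in>\<S>. \<not> is_clique F S)"
    have p1: "\<forall>\<^sub>F n in sequentially. ?p n \<le> 1"
      using pC by eventually_elim (use p in \<open>blast intro: order_trans\<close>)
    have "(\<lambda>n. subset_prob (all_pairs n) (?p n) (?fail n)) \<longlonglongrightarrow> 0"
    proof (rule prob_family_without_clique_tendsto_0[OF assms(1) \<beta> _ _ C p1])
      show "\<forall>\<^sub>F n in sequentially. real (card (extensible_family (G n) k (Suc j) n)) \<le> exp (K * real n)"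
        using eventually_gt_at_top[of 0]
        unfolding K_def by eventually_elim (rule card_extensible_family_le)
    qed (rule extensible_family_members)
    then have "(\<lambda>n. 1 - subset_prob (all_pairs n) (?p n) (?fail n)) \<longlonglongrightarrow> 1 - 0"
      by (intro tendsto_diff tendsto_const)
    then have lim: "(\<lambda>n. 1 - subset_prob (all_pairs n) (?p n) (?fail n)) \<longlonglongrightarrow> 1" by simp
    show "(\<lambda>n. random_graph_prob n (p n) (?A n)) \<longlonglongrightarrow> 1"
      unfolding random_graph_prob_eq_subset_prob
    proof (rule tendsto_sandwich[OF _ _ lim tendsto_const])
      show "\<forall>\<^sub>F n in sequentially. subset_prob (all_pairs n) (p n) (?A n) \<le> 1"
        using p by (intro always_eventually allI subset_prob_le_1[OF finite_all_pairs]) auto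
      show "\<forall>\<^sub>F n in sequentially. 1 - subset_prob (all_pairs n) (?p n) (?fail n)
          \<le> subset_prob (all_pairs n) (p n) (?A n)"
        using pC p1 deg eventually_ge_at_top[of "max (max N N') 1"]
      proof eventually_elim
        case (elim n)
        have p0: "0 \<le> ?p n" using C by simp
        have n: "N \<le> n" "real N' \<le> real n" "0 < n" using elim(4) by auto
        have "1 - subset_prob (all_pairs n) (?p n) (?fail n) =
            subset_prob (all_pairs n) (?p n) (\<lambda>F. \<not> ?fail n F)"
          by (rule subset_prob_not[OF finite_all_pairs, symmetric])
        also have "\<dots> \<le> subset_prob (all_pairs n) (?p n) (?A n)"
        proof (rule subset_prob_mono[OF p0 elim(2)])
          fix F assume "\<not> ?fail n F"
          then have hits: "hits_extensible (G n) k (Suc j) \<beta> n F"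
            unfolding hits_extensible_def by blast
          have "real r / \<eta>\<^sup>2 \<le> real n" using N' n by linarith
          then have "real r \<le> \<eta>\<^sup>2 * real n" using \<eta> by (simp add: field_simps)
          then have "greedy_tiling n k r (G n) F \<alpha> \<gamma> \<eta> j"
            using k0 assms(2-4) \<eta> n(3) G elim(3) blobs[OF n(1) _ _ _ hits]
            by unfold_locales (auto simp: j_def \<eta>_def)
          then show "?A n F" by (rule greedy_tiling.almost_perfect_tiling)
        qed
        \<comment> \<open>Additional random edges preserve a tiling, so the estimate passes to every
          larger density.\<close>
        also have "\<dots> \<le> subset_prob (all_pairs n) (p n) (?A n)"
        proof (rule subset_prob_mono_p[OF finite_all_pairs p0 elim(1)])
          show "p n \<le> 1" using p by simp
          show "?A n F'" if "?A n F" "F \<subseteq> F'" for F F'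
            using that Kr_tiling_mono[of n r "G n \<union> F" _ "G n \<union> F'"] by blast
        qed
        finally show ?case .
      qed
    qed
  qed
qed

end
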